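(* Let $\mathbb{A}$ be a commutative ring with unit, let $\mathfrak{m}\subset\mathbb{A}$ be an ideal with $\mathfrak{m}^2=0$, and let $Q$ be a rack with associated Yang-Baxter operator $c_Q\colon \mathbb{A}Q\otimes\mathbb{A}Q\to\mathbb{A}Q\otimes\mathbb{A}Q$, $x\otimes y\mapsto y\otimes (x\ast y)$. Then every entropic deformation of $c_Q$ (with respect to $\mathfrak{m}$) satisfies the Yang-Baxter equation. If moreover $|\operatorname{Inn}(Q)|$ is invertible in $\mathbb{A}$, then every Yang-Baxter deformation of $c_Q$ (with respect to $\mathfrak{m}$) is equivalent (with respect to $\mathfrak{m}$) to exactly one entropic deformation of $c_Q$.
   Context: All tensor products are over $\mathbb{A}$; $\mathrm{I}$ is the identity of a module $V$ and $\mathrm{II}=\mathrm{I}\otimes\mathrm{I}$. A rack is a set $Q$ with a binary operation $(x,y)\mapsto x\ast y=x^y$ such that every right translation $\varrho(y)\colon x\mapsto x\ast y$ is a bijection of $Q$ and $(x\ast y)\ast z=(x\ast z)\ast(y\ast z)$ for all $x,y,z$. $\operatorname{Inn}(Q)$ is the group of automorphisms of $Q$ generated by all $\varrho(y)$, $y\in Q$. $V=\mathbb{A}Q$ is the free $\mathbb{A}$-module with basis $Q$; $\mathbb{A}Q^n$ is identified with $V^{\otimes n}$. A Yang-Baxter operator on $V$ is an automorphism $c$ of $V\otimes V$ satisfying the Yang-Baxter equation $(c\otimes\mathrm{I})(\mathrm{I}\otimes c)(c\otimes\mathrm{I})=(\mathrm{I}\otimes c)(c\otimes\mathrm{I})(\mathrm{I}\otimes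 c)$. A Yang-Baxter deformation of $c$ with respect to $\mathfrak{m}$ is a Yang-Baxter operator $\tilde c$ on $V$ with $\tilde c\equiv c$ modulo $\mathfrak{m}$. Two Yang-Baxter operators $c,\tilde c$ are equivalent with respect to $\mathfrak{m}$ if there is an automorphism $\alpha\colon V\to V$ with $\alpha\equiv\mathrm{I}$ modulo $\mathfrak{m}$ and $\tilde c=(\alpha\otimes\alpha)\,c\,(\alpha\otimes\alpha)^{-1}$. An $\mathbb{A}$-linear map $f\colon\mathbb{A}Q^n\to\mathbb{A}Q^n$ is entropic (with respect to $c_Q$) if for each $i=0,\dots,n$ one has, on $V^{\otimes(n+1)}$, $$(c_n\cdots c_{i+1})^{-1}(f\otimes\mathrm{I})(c_n\cdots c_{i+1})=(c_1\cdots c_i)^{-1}(\mathrm{I}\otimes f)(c_1\cdots c_i),$$ where $c_j=\mathrm{I}^{\otimes(j-1)}\otimes c_Q\otimes\mathrm{I}^{\otimes(n-j)}$ and products are compositions of maps (rightmost applied first). An entropic deformation of $c_Q$ (with respect to $\mathfrak{m}$) is a map $c=c_Qf$ (composition) with $f\colon\mathbb{A}Q^2\to\mathbb{A}Q^2$ entropic and $f\equiv\mathrm{II}$ modulo $\mathfrak{m}$. *)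

theory Defs
  imports Complex_Main "HOL-Library.Poly_Mapping" "HOL-Algebra.Bij" "HOL-Algebra.Generated_Groups"
begin

section \<open>Racks and their inner automorphism groups\<close>

locale rack =
  fixes rop :: "'q \<Rightarrow> 'q \<Rightarrow> 'q"
  assumes bij_right_translation: "bij (\<lambda>x. rop x y)"
    and self_distrib: "rop (rop x y) z = rop (rop x z) (rop y z)"

text \<open>The ambient group is the symmetric group of the underlying type; for a rack the right
  translations are automorphisms, so this is the subgroup they generate in the automorphism
  group as well.\<close>

definition Inn :: "('q \<Rightarrow> 'q \<Rightarrow> 'q) \<Rightarrow> ('q \<Rightarrow> 'q) set" where
  "Inn rop = generate (BijGroup UNIV) (range (\<lambda>y x. rop x y))"


section \<open>Ideals with vanishing square\<close>

definition is_ideal :: "'a::comm_ring_1 set \<Rightarrow> bool" where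
  "is_ideal m \<longleftrightarrow> 0 \<in> m \<and> (\<forall>x\<in>m. \<forall>y\<in>m. x + y \<in> m) \<and> (\<forall>a. \<forall>x\<in>m. a * x \<in> m)"

text \<open>The ideal \<open>m\<^sup>2\<close> is generated by the products \<open>x * y\<close>, so it vanishes iff they all do.\<close>

definition square_zero :: "'a::comm_ring_1 set \<Rightarrow> bool" where
  "square_zero m \<longleftrightarrow> (\<forall>x\<in>m. \<forall>y\<in>m. x * y = 0)"


section \<open>Free modules and tensor products of linear maps\<close>

text \<open>The free module on the type \<open>'x\<close> is \<open>'x \<Rightarrow>\<^sub>0 'a\<close>. The tensor product of the free modules on
  \<open>'x\<close> and \<open>'y\<close> is the free module on \<open>'x \<times> 'y\<close>, where the basis element \<open>(x, y)\<close> stands for the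
  tensor product of the basis elements \<open>x\<close> and \<open>y\<close>.\<close>

definition scal :: "'a::comm_ring_1 \<Rightarrow> ('x \<Rightarrow>\<^sub>0 'a) \<Rightarrow> ('x \<Rightarrow>\<^sub>0 'a)" where
  "scal a v = Poly_Mapping.map ((*) a) v"

lemma lookup_scal [simp]: "Poly_Mapping.lookup (scal a v) k = a * Poly_Mapping.lookup v k"
  by (cases "Poly_Mapping.lookup v k = 0") (simp_all add: scal_def Poly_Mapping.map.rep_eq)

lemma module_scal: "module scal"
  by unfold_locales
    (auto intro!: poly_mapping_eqI simp: lookup_add algebra_simps)

abbreviation basis :: "'x \<Rightarrow> ('x \<Rightarrow>\<^sub>0 'a::comm_ring_1)" where
  "basis x \<equiv> Poly_Mapping.single x 1"

abbreviation lin :: "(('x \<Rightarrow>\<^sub>0 'a::comm_ring_1) \<Rightarrow> ('y \<Rightarrow>\<^sub>0 'a)) \<Rightarrow> bool" where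
  "lin f \<equiv> module_hom scal scal f"

definition lin_aut :: "(('x \<Rightarrow>\<^sub>0 'a::comm_ring_1) \<Rightarrow> ('x \<Rightarrow>\<^sub>0 'a)) \<Rightarrow> bool" where
  "lin_aut f \<longleftrightarrow> lin f \<and> bij f"

text \<open>The linear map with prescribed values on the basis.\<close>

definition lin_ext :: "('x \<Rightarrow> ('y \<Rightarrow>\<^sub>0 'a)) \<Rightarrow> ('x \<Rightarrow>\<^sub>0 'a::comm_ring_1) \<Rightarrow> ('y \<Rightarrow>\<^sub>0 'a)" where
  "lin_ext g v = (\<Sum>x\<in>Poly_Mapping.keys v. scal (Poly_Mapping.lookup v x) (g x))"

definition tensor_vec ::
    "('x \<Rightarrow>\<^sub>0 'a) \<Rightarrow> ('y \<Rightarrow>\<^sub>0 'a) \<Rightarrow> ('x \<times> 'y \<Rightarrow>\<^sub>0 'a::comm_ring_1)" where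
  "tensor_vec v w = (\<Sum>x\<in>Poly_Mapping.keys v. \<Sum>y\<in>Poly_Mapping.keys w.
     Poly_Mapping.single (x, y) (Poly_Mapping.lookup v x * Poly_Mapping.lookup w y))"

definition tensor_map ::
    "(('x \<Rightarrow>\<^sub>0 'a) \<Rightarrow> ('x' \<Rightarrow>\<^sub>0 'a)) \<Rightarrow> (('y \<Rightarrow>\<^sub>0 'a) \<Rightarrow> ('y' \<Rightarrow>\<^sub>0 'a))
      \<Rightarrow> ('x \<times> 'y \<Rightarrow>\<^sub>0 'a::comm_ring_1) \<Rightarrow> ('x' \<times> 'y' \<Rightarrow>\<^sub>0 'a)" where
  "tensor_map f g = lin_ext (\<lambda>(x, y). tensor_vec (f (basis x)) (g (basis y)))"

definition assoc :: "(('x \<times> 'y) \<times> 'z \<Rightarrow>\<^sub>0 'a::comm_ring_1) \<Rightarrow> ('x \<times> 'y \<times> 'z \<Rightarrow>\<^sub>0 'a)" where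
  "assoc = lin_ext (\<lambda>((x, y), z). basis (x, y, z))"

definition unassoc :: "('x \<times> 'y \<times> 'z \<Rightarrow>\<^sub>0 'a::comm_ring_1) \<Rightarrow> (('x \<times> 'y) \<times> 'z \<Rightarrow>\<^sub>0 'a)" where
  "unassoc = lin_ext (\<lambda>(x, y, z). basis ((x, y), z))"

text \<open>\<open>f \<otimes> I\<close> and \<open>I \<otimes> f\<close> on the threefold tensor power.\<close>

definition strand12 :: "(('q \<times> 'q \<Rightarrow>\<^sub>0 'a) \<Rightarrow> ('q \<times> 'q \<Rightarrow>\<^sub>0 'a))
      \<Rightarrow> ('q \<times> 'q \<times> 'q \<Rightarrow>\<^sub>0 'a::comm_ring_1) \<Rightarrow> ('q \<times> 'q \<times> 'q \<Rightarrow>\<^sub>0 'a)" where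
  "strand12 f = assoc \<circ> tensor_map f id \<circ> unassoc"

definition strand23 :: "(('q \<times> 'q \<Rightarrow>\<^sub>0 'a) \<Rightarrow> ('q \<times> 'q \<Rightarrow>\<^sub>0 'a))
      \<Rightarrow> ('q \<times> 'q \<times> 'q \<Rightarrow>\<^sub>0 'a::comm_ring_1) \<Rightarrow> ('q \<times> 'q \<times> 'q \<Rightarrow>\<^sub>0 'a)" where
  "strand23 f = tensor_map id f"

text \<open>Congruence of maps between free modules modulo an ideal. For an ideal \<open>m\<close> of \<open>'a\<close>, a vector
  lies in \<open>m\<close> times the free module iff all of its coefficients lie in \<open>m\<close>.\<close>

definition cong_mod ::
    "'a::comm_ring_1 set \<Rightarrow> (('x \<Rightarrow>\<^sub>0 'a) \<Rightarrow> ('y \<Rightarrow>\<^sub>0 'a)) \<Rightarrow> (('x \<Rightarrow>\<^sub>0 'a) \<Rightarrow> ('y \<Rightarrow>\<^sub>0 'a)) \<Rightarrow> bool" where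
  "cong_mod m f g \<longleftrightarrow> (\<forall>v k. Poly_Mapping.lookup (f v - g v) k \<in> m)"


section \<open>Yang-Baxter operators, deformations and equivalence\<close>

definition yang_baxter_eq ::
    "(('q \<times> 'q \<Rightarrow>\<^sub>0 'a::comm_ring_1) \<Rightarrow> ('q \<times> 'q \<Rightarrow>\<^sub>0 'a)) \<Rightarrow> bool" where
  "yang_baxter_eq c \<longleftrightarrow>
     strand12 c \<circ> strand23 c \<circ> strand12 c = strand23 c \<circ> strand12 c \<circ> strand23 c"

definition yang_baxter_operator ::
    "(('q \<times> 'q \<Rightarrow>\<^sub>0 'a::comm_ring_1) \<Rightarrow> ('q \<times> 'q \<Rightarrow>\<^sub>0 'a)) \<Rightarrow> bool" where
  "yang_baxter_operator c \<longleftrightarrow> lin_aut c \<and> yang_baxter_eq c"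

definition yang_baxter_deformation ::
    "'a::comm_ring_1 set \<Rightarrow> (('q \<times> 'q \<Rightarrow>\<^sub>0 'a) \<Rightarrow> ('q \<times> 'q \<Rightarrow>\<^sub>0 'a))
      \<Rightarrow> (('q \<times> 'q \<Rightarrow>\<^sub>0 'a) \<Rightarrow> ('q \<times> 'q \<Rightarrow>\<^sub>0 'a)) \<Rightarrow> bool" where
  "yang_baxter_deformation m c c' \<longleftrightarrow> yang_baxter_operator c' \<and> cong_mod m c' c"

definition yb_equivalent ::
    "'a::comm_ring_1 set \<Rightarrow> (('q \<times> 'q \<Rightarrow>\<^sub>0 'a) \<Rightarrow> ('q \<times> 'q \<Rightarrow>\<^sub>0 'a))
      \<Rightarrow> (('q \<times> 'q \<Rightarrow>\<^sub>0 'a) \<Rightarrow> ('q \<times> 'q \<Rightarrow>\<^sub>0 'a)) \<Rightarrow> bool" where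
  "yb_equivalent m c c' \<longleftrightarrow> yang_baxter_operator c \<and> yang_baxter_operator c' \<and>
     (\<exists>\<alpha> :: ('q \<Rightarrow>\<^sub>0 'a) \<Rightarrow> ('q \<Rightarrow>\<^sub>0 'a). lin_aut \<alpha> \<and> cong_mod m \<alpha> id \<and>
        c' = tensor_map \<alpha> \<alpha> \<circ> c \<circ> inv_into UNIV (tensor_map \<alpha> \<alpha>))"


section \<open>The operator of a rack and its entropic deformations\<close>

definition rack_operator ::
    "('q \<Rightarrow> 'q \<Rightarrow> 'q) \<Rightarrow> ('q \<times> 'q \<Rightarrow>\<^sub>0 'a::comm_ring_1) \<Rightarrow> ('q \<times> 'q \<Rightarrow>\<^sub>0 'a)" where
  "rack_operator rop = lin_ext (\<lambda>(x, y). basis (y, rop x y))"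

text \<open>Entropic maps on the \<open>n\<close>-th tensor power for \<open>n = 2\<close>. With
  \<open>c\<^sub>1 = c \<otimes> I\<close> and \<open>c\<^sub>2 = I \<otimes> c\<close>, the requirement
  \<open>(c\<^sub>n \<dots> c\<^sub>i\<^sub>+\<^sub>1)\<^sup>-\<^sup>1 (f \<otimes> I) (c\<^sub>n \<dots> c\<^sub>i\<^sub>+\<^sub>1) = (c\<^sub>1 \<dots> c\<^sub>i)\<^sup>-\<^sup>1 (I \<otimes> f) (c\<^sub>1 \<dots> c\<^sub>i)\<close>
  is written out for \<open>i = 0, 1, 2\<close>, in this order; empty products are the identity.\<close>

definition entropic ::
    "('q \<Rightarrow> 'q \<Rightarrow> 'q) \<Rightarrow> (('q \<times> 'q \<Rightarrow>\<^sub>0 'a::comm_ring_1) \<Rightarrow> ('q \<times> 'q \<Rightarrow>\<^sub>0 'a)) \<Rightarrow> bool" where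
  "entropic rop f \<longleftrightarrow> lin f \<and>
     (let c1 = strand12 (rack_operator rop); c2 = strand23 (rack_operator rop) in
        inv_into UNIV (c2 \<circ> c1) \<circ> strand12 f \<circ> (c2 \<circ> c1) = strand23 f \<and>
        inv_into UNIV c2 \<circ> strand12 f \<circ> c2 = inv_into UNIV c1 \<circ> strand23 f \<circ> c1 \<and>
        strand12 f = inv_into UNIV (c1 \<circ> c2) \<circ> strand23 f \<circ> (c1 \<circ> c2))"

definition entropic_deformation ::
    "'a::comm_ring_1 set \<Rightarrow> ('q \<Rightarrow> 'q \<Rightarrow> 'q)
      \<Rightarrow> (('q \<times> 'q \<Rightarrow>\<^sub>0 'a) \<Rightarrow> ('q \<times> 'q \<Rightarrow>\<^sub>0 'a)) \<Rightarrow> bool" where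
  "entropic_deformation m rop c \<longleftrightarrow>
     (\<exists>f. entropic rop f \<and> cong_mod m f id \<and> c = rack_operator rop \<circ> f)"

end

theory Submission
  imports Defs
begin

text \<open>Write \<open>c\<close> for the operator of the rack and \<open>x * y\<close> for \<open>rop x y\<close>. Since \<open>m\<^sup>2 = 0\<close>, maps congruent to the identity
  modulo \<open>m\<close> compose by adding their deviations from the identity. Everything therefore becomes
  linear in the matrix \<open>e\<close> of \<open>f - II\<close>, where a deformation is written as \<open>c f\<close>. Moving all copies
  of \<open>c\<close> to the left turns the Yang-Baxter equation for \<open>c f\<close> into \<open>d\<^sub>0 e - d\<^sub>1 e + d\<^sub>2 e = 0\<close>
  (\<open>yang_baxter_iff\<close>), while \<open>f\<close> is entropic iff each of the three faces \<open>d\<^sub>i e\<close> vanishes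
  (\<open>entropic_iff\<close>). This gives the first claim. An equivalence by \<open>\<alpha> = I + a\<close> replaces \<open>e\<close> by
  \<open>e + \<delta> a\<close> for a coboundary map \<open>\<delta>\<close> (\<open>equivalence_iff\<close>). The second claim says that every
  cocycle is cohomologous to exactly one entropic one.

  Existence takes two steps. A cocycle \<open>e\<close> and its transform under a right translation by \<open>t\<close>
  differ by the coboundary of \<open>a x u = e (x, t) (u, t)\<close>, hence the transform of \<open>e\<close> under any inner
  automorphism is cohomologous to \<open>e\<close>. As the order of the inner group is invertible, \<open>e\<close> may be
  replaced by its average, which is invariant (\<open>cocycle_average\<close>). For an invariant cocycle the
  equation splits according to whether \<open>z\<close> and \<open>w\<close> act in the same way: the entries
  \<open>e (x, z) (u, w)\<close> with \<open>z\<close> and \<open>w\<close> acting alike are already entropic, and the others are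
  themselves the entries of a coboundary, which can be subtracted (\<open>equivariant_cocycle_entropic\<close>).

  For uniqueness, the only entries of an entropic coboundary that can be nonzero are of the form
  \<open>a (x * y) (u * y) - a x u\<close> and invariant under inner automorphisms of \<open>x\<close> and \<open>u\<close>. Summed over
  the inner group such a difference cancels, and so it is zero (\<open>entropic_coboundary_zero\<close>).

  The rack may be infinite. A matrix then describes a linear map only if its columns have finite
  support, and each construction has to preserve this.\<close>

section \<open>Column-finite matrices and matrices over an ideal\<close>

text \<open>The entry \<open>M p q\<close> is the coefficient at \<open>q\<close> of the image of the basis vector \<open>p\<close>, so the
  columns are the functions \<open>M p\<close>.\<close>

definition column_finite :: "('x \<Rightarrow> 'y \<Rightarrow> 'a::zero) \<Rightarrow> bool" where
  "column_finite M \<longleftrightarrow> (\<forall>p. finite {q. M p q \<noteq> 0})"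

definition entries_in :: "'a set \<Rightarrow> ('x \<Rightarrow> 'y \<Rightarrow> 'a) \<Rightarrow> bool" where
  "entries_in m M \<longleftrightarrow> (\<forall>p q. M p q \<in> m)"

lemma ideal_closed:
  assumes "is_ideal m"
  shows "0 \<in> m" "x \<in> m \<Longrightarrow> y \<in> m \<Longrightarrow> x + y \<in> m" "x \<in> m \<Longrightarrow> a * x \<in> m"
    "x \<in> m \<Longrightarrow> x * a \<in> m" "x \<in> m \<Longrightarrow> - x \<in> m" "x \<in> m \<Longrightarrow> y \<in> m \<Longrightarrow> x - y \<in> m"
proof -
  show *: "0 \<in> m" "x \<in> m \<Longrightarrow> y \<in> m \<Longrightarrow> x + y \<in> m" "x \<in> m \<Longrightarrow> a * x \<in> m" for x y a
    using assms unfolding is_ideal_def by blast+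
  show "x \<in> m \<Longrightarrow> x * a \<in> m" using *(3)[of x a] by (simp add: mult.commute)
  show neg: "x \<in> m \<Longrightarrow> - x \<in> m" for x using *(3)[of x "-1"] by simp
  show "x \<in> m \<Longrightarrow> y \<in> m \<Longrightarrow> x - y \<in> m" using *(2)[of x "- y"] neg[of y] by simp
qed

lemma ideal_sum:
  assumes "is_ideal m" and "\<And>i. i \<in> I \<Longrightarrow> f i \<in> m"
  shows "(\<Sum>i\<in>I. f i) \<in> m"
  using assms(2) by (induction I rule: infinite_finite_induct) (auto simp: ideal_closed[OF assms(1)])

lemma column_finite_transport:
  assumes "column_finite M" and "inj k"
  shows "column_finite (\<lambda>p q. M (h p) (k q))"
  unfolding column_finite_def
proof
  fix p
  have "{q. M (h p) (k q) \<noteq> 0} = k -` {q. M (h p) q \<noteq> 0}" by auto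
  then show "finite {q. M (h p) (k q) \<noteq> 0}"
    using assms finite_vimageI[of "{q. M (h p) q \<noteq> 0}" k] by (simp add: column_finite_def)
qed

lemma column_finite_add:
  fixes M N :: "'x \<Rightarrow> 'y \<Rightarrow> 'a::monoid_add"
  assumes "column_finite M" and "column_finite N"
  shows "column_finite (\<lambda>p q. M p q + N p q)"
  unfolding column_finite_def
proof
  fix p
  have "{q. M p q + N p q \<noteq> 0} \<subseteq> {q. M p q \<noteq> 0} \<union> {q. N p q \<noteq> 0}" by auto
  then show "finite {q. M p q + N p q \<noteq> 0}"
    by (rule finite_subset) (use assms in \<open>simp add: column_finite_def\<close>)
qed

lemma column_finite_mult:
  fixes M :: "'x \<Rightarrow> 'y \<Rightarrow> 'a::mult_zero"
  assumes "column_finite M"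
  shows "column_finite (\<lambda>p q. r * M p q)"
  unfolding column_finite_def
proof
  fix p
  have "{q. r * M p q \<noteq> 0} \<subseteq> {q. M p q \<noteq> 0}" by auto
  then show "finite {q. r * M p q \<noteq> 0}"
    by (rule finite_subset) (use assms in \<open>simp add: column_finite_def\<close>)
qed

lemma column_finite_sum:
  fixes M :: "'i \<Rightarrow> 'x \<Rightarrow> 'y \<Rightarrow> 'a::comm_monoid_add"
  assumes "\<And>i. i \<in> I \<Longrightarrow> column_finite (M i)"
  shows "column_finite (\<lambda>p q. \<Sum>i\<in>I. M i p q)"
  using assms
proof (induction I rule: infinite_finite_induct)
  case (insert i I)
  then show ?case by (simp add: column_finite_add)
qed (simp_all add: column_finite_def)

section \<open>Rack automorphisms and the inner group\<close>

lemma BijGroup_UNIV_mult: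
  assumes "bij g" and "bij h" shows "g \<otimes>\<^bsub>BijGroup UNIV\<^esub> h = g \<circ> h"
  using assms by (simp add: BijGroup_def Bij_def compose_def fun_eq_iff)

lemma BijGroup_UNIV_carrier: "carrier (BijGroup UNIV) = {g. bij g}"
  by (auto simp: BijGroup_def Bij_def)

lemma BijGroup_UNIV_one: "\<one>\<^bsub>BijGroup UNIV\<^esub> = id"
  by (auto simp: BijGroup_def)

lemma BijGroup_UNIV_inv:
  assumes "bij g" shows "inv\<^bsub>BijGroup UNIV\<^esub> g = inv_into UNIV g"
proof -
  interpret group "BijGroup (UNIV::'x set)" by (rule group_BijGroup)
  show ?thesis
    by (rule inv_equality)
      (use assms in \<open>simp_all add: BijGroup_UNIV_carrier BijGroup_UNIV_mult BijGroup_UNIV_one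
         bij_imp_bij_inv bij_is_inj\<close>)
qed

context rack
begin

lemma right_translation_inj [simp]: "rop x y = rop x' y \<longleftrightarrow> x = x'"
  using bij_right_translation[of y] by (auto simp: bij_def inj_def)

lemma right_translation_surj: obtains x where "rop x y = t"
  using bij_right_translation[of y] by (metis bij_pointE)

definition rack_aut :: "('q \<Rightarrow> 'q) \<Rightarrow> bool" where
  "rack_aut g \<longleftrightarrow> bij g \<and> (\<forall>x y. g (rop x y) = rop (g x) (g y))"

lemma rack_aut_eq_iff: "rack_aut g \<Longrightarrow> g x = g y \<longleftrightarrow> x = y"
  by (auto simp: rack_aut_def bij_def inj_def)

lemma rack_aut_rop: "rack_aut g \<Longrightarrow> g (rop x y) = rop (g x) (g y)"
  by (simp add: rack_aut_def)

lemma rack_aut_translation: "rack_aut (\<lambda>x. rop x y)"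
  by (simp add: rack_aut_def bij_right_translation flip: self_distrib)

lemma rack_aut_comp: "rack_aut g \<Longrightarrow> rack_aut h \<Longrightarrow> rack_aut (g \<circ> h)"
  by (simp add: rack_aut_def bij_comp)

lemma rack_aut_inv: assumes "rack_aut g" shows "rack_aut (inv_into UNIV g)"
proof -
  have g: "bij g" "\<And>x y. g (rop x y) = rop (g x) (g y)"
    using assms by (auto simp: rack_aut_def)
  have "inv_into UNIV g (rop x y) = rop (inv_into UNIV g x) (inv_into UNIV g y)" for x y
  proof -
    have "g (rop (inv_into UNIV g x) (inv_into UNIV g y)) = rop x y"
      by (simp add: g bij_is_surj surj_f_inv_f)
    then show ?thesis by (metis g(1) bij_inv_eq_iff)
  qed
  then show ?thesis using g by (simp add: rack_aut_def bij_imp_bij_inv)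
qed

lemma translation_in_Inn: "(\<lambda>x. rop x y) \<in> Inn rop"
  unfolding Inn_def by (rule generate.incl) auto

text \<open>The conclusion includes that \<open>g\<close> is an automorphism because the step for products needs this of
  both factors.\<close>

lemma Inn_rack_aut_induct [consumes 1, case_names id translation inv comp]:
  assumes "g \<in> Inn rop"
    and id: "P id"
    and translation: "\<And>y. P (\<lambda>x. rop x y)"
    and inv: "\<And>y. P (inv_into UNIV (\<lambda>x. rop x y))"
    and comp: "\<And>g h. rack_aut g \<Longrightarrow> rack_aut h \<Longrightarrow> P g \<Longrightarrow> P h \<Longrightarrow> P (g \<circ> h)"
  shows "rack_aut g \<and> P g"
  using assms(1) unfolding Inn_def
proof (induction rule: generate.induct)
  case one
  have "rack_aut id" by (simp add: rack_aut_def)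
  then show ?case using id by (simp only: BijGroup_UNIV_one)
next
  case (incl h)
  then show ?case using translation rack_aut_translation by blast
next
  case (inv h)
  then obtain y where h: "h = (\<lambda>x. rop x y)" by blast
  then have "bij h" using bij_right_translation by blast
  then show ?case
    using h assms(4) rack_aut_inv[OF rack_aut_translation] by (simp add: BijGroup_UNIV_inv)
next
  case (eng g h)
  then have "bij g" and "bij h" by (simp_all add: rack_aut_def)
  with eng show ?case using comp rack_aut_comp by (simp only: BijGroup_UNIV_mult)
qed

lemma Inn_rack_aut: "g \<in> Inn rop \<Longrightarrow> rack_aut g"
  using Inn_rack_aut_induct[where P = "\<lambda>_. True"] by blast

lemma Inn_comp: assumes "g \<in> Inn rop" and "h \<in> Inn rop" shows "g \<circ> h \<in> Inn rop"
proof -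
  have "g \<otimes>\<^bsub>BijGroup UNIV\<^esub> h \<in> Inn rop"
    using assms unfolding Inn_def by (rule generate.eng)
  then show ?thesis
    using assms[THEN Inn_rack_aut] by (simp add: BijGroup_UNIV_mult rack_aut_def)
qed

text \<open>Multiplication by a translation permutes the finite group \<open>Inn\<close>. This and the next lemma are
  the two forms of invariance behind averaging over the group.\<close>

lemma sum_Inn_left:
  assumes "finite (Inn rop)"
  shows "(\<Sum>g\<in>Inn rop. F (\<lambda>x. rop (g x) y)) = (\<Sum>g\<in>Inn rop. F g)"
proof -
  let ?L = "\<lambda>g x. rop (g x) y"
  have inj: "inj_on ?L (Inn rop)" by (auto simp: inj_on_def fun_eq_iff)
  moreover have "?L g \<in> Inn rop" if "g \<in> Inn rop" for g
    using Inn_comp[OF translation_in_Inn that, of y] by (simp add: comp_def)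
  ultimately have "?L ` Inn rop = Inn rop"
    using assms by (intro endo_inj_surj) auto
  with inj show ?thesis
    using sum.reindex[of ?L "Inn rop" F] by simp
qed

lemma sum_Inn_right:
  assumes "finite (Inn rop)"
  shows "(\<Sum>g\<in>Inn rop. F (\<lambda>x. g (rop x y))) = (\<Sum>g\<in>Inn rop. F g)"
proof -
  let ?R = "\<lambda>g x. g (rop x y)"
  have inj: "inj_on ?R (Inn rop)"
  proof (rule inj_onI)
    fix g h assume *: "?R g = ?R h"
    show "g = h"
    proof
      fix t obtain x where "rop x y = t" by (rule right_translation_surj)
      then show "g t = h t" using fun_cong[OF *, of x] by simp
    qed
  qed
  moreover have "?R g \<in> Inn rop" if "g \<in> Inn rop" for g
    using Inn_comp[OF that translation_in_Inn, of y] by (simp add: comp_def)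
  ultimately have "?R ` Inn rop = Inn rop"
    using assms by (intro endo_inj_surj) auto
  with inj show ?thesis
    using sum.reindex[of ?R "Inn rop" F] by simp
qed

section \<open>Cochains, faces and coboundaries\<close>

text \<open>The face \<open>d\<^sub>i e\<close> is the matrix of the difference of the two sides of the entropic condition with
  index \<open>i\<close>, where the rack operator acts on basis triples by permuting them: the strand in
  position \<open>i\<close> is pulled out to the right, or to the left, of the two strands on which \<open>e\<close> acts.\<close>

definition face0 :: "('q \<times> 'q \<Rightarrow> 'q \<times> 'q \<Rightarrow> 'a::comm_ring_1) \<Rightarrow> _" where
  "face0 e = (\<lambda>(x, y, z) (u, v, w).
     e (y, z) (v, w) * (of_bool (rop (rop x y) z = rop (rop u v) w) - of_bool (x = u)))"

definition face1 :: "('q \<times> 'q \<Rightarrow> 'q \<times> 'q \<Rightarrow> 'a::comm_ring_1) \<Rightarrow> _" where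
  "face1 e = (\<lambda>(x, y, z) (u, v, w).
     e (x, z) (u, w) * of_bool (rop y z = rop v w) - e (rop x y, z) (rop u v, w) * of_bool (y = v))"

definition face2 :: "('q \<times> 'q \<Rightarrow> 'q \<times> 'q \<Rightarrow> 'a::comm_ring_1) \<Rightarrow> _" where
  "face2 e = (\<lambda>(x, y, z) (u, v, w).
     (e (x, y) (u, v) - e (rop x z, rop y z) (rop u w, rop v w)) * of_bool (z = w))"

lemmas face_defs = face0_def face1_def face2_def

definition cocycle :: "('q \<times> 'q \<Rightarrow> 'q \<times> 'q \<Rightarrow> 'a::comm_ring_1) \<Rightarrow> bool" where
  "cocycle e \<longleftrightarrow> (\<forall>p q. face0 e p q - face1 e p q + face2 e p q = 0)"

definition entropic_matrix :: "('q \<times> 'q \<Rightarrow> 'q \<times> 'q \<Rightarrow> 'a::comm_ring_1) \<Rightarrow> bool" where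
  "entropic_matrix e \<longleftrightarrow> (\<forall>p q. face0 e p q = 0 \<and> face1 e p q = 0 \<and> face2 e p q = 0)"

text \<open>The matrix of \<open>c\<^sup>-\<^sup>1 A c - A\<close> for \<open>A = a \<otimes> I + I \<otimes> a\<close>, which is the first-order effect on
  \<open>c\<^sup>-\<^sup>1 c'\<close> of conjugating the deformation \<open>c'\<close> with \<open>(I + a) \<otimes> (I + a)\<close>.\<close>

definition coboundary :: "('q \<Rightarrow> 'q \<Rightarrow> 'a::comm_ring_1) \<Rightarrow> ('q \<times> 'q \<Rightarrow> 'q \<times> 'q \<Rightarrow> 'a)" where
  "coboundary a = (\<lambda>(x, y) (u, v).
     a y v * (of_bool (rop x y = rop u v) - of_bool (x = u))
     + (a (rop x y) (rop u v) - a x u) * of_bool (y = v))"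

definition twist :: "('q \<Rightarrow> 'q) \<Rightarrow> ('q \<times> 'q \<Rightarrow> 'q \<times> 'q \<Rightarrow> 'a) \<Rightarrow> ('q \<times> 'q \<Rightarrow> 'q \<times> 'q \<Rightarrow> 'a)"
  where "twist g e p q = e (map_prod g g p) (map_prod g g q)"

lemma coboundary_twist:
  assumes "rack_aut g"
  shows "twist g (coboundary a) p q = coboundary (\<lambda>x u. a (g x) (g u)) p q"
  using assms by (cases p; cases q)
    (simp add: twist_def coboundary_def rack_aut_eq_iff flip: rack_aut_rop)

lemma coboundary_add:
  "coboundary (\<lambda>x u. a x u + b x u) p q = coboundary a p q + coboundary b p q"
  by (cases p; cases q) (simp add: coboundary_def algebra_simps)

lemma coboundary_diff:
  "coboundary (\<lambda>x u. a x u - b x u) p q = coboundary a p q - coboundary b p q"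
  by (cases p; cases q) (simp add: coboundary_def algebra_simps)

lemma coboundary_mult:
  "coboundary (\<lambda>x u. r * a x u) p q = r * coboundary a p q"
  by (cases p; cases q) (simp add: coboundary_def algebra_simps)

lemma coboundary_zero: "coboundary (\<lambda>x u. 0) p q = 0"
  by (cases p; cases q) (simp add: coboundary_def)

lemma coboundary_sum:
  "coboundary (\<lambda>x u. \<Sum>i\<in>I. a i x u) p q = (\<Sum>i\<in>I. coboundary (a i) p q)"
  by (induction I rule: infinite_finite_induct) (simp_all add: coboundary_zero coboundary_add)

lemma entropic_matrix_diff:
  assumes "entropic_matrix e" and "entropic_matrix e'"
  shows "entropic_matrix (\<lambda>p q. e p q - e' p q)"
proof -
  have "face0 (\<lambda>p q. e p q - e' p q) p q = face0 e p q - face0 e' p q"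
    "face1 (\<lambda>p q. e p q - e' p q) p q = face1 e p q - face1 e' p q"
    "face2 (\<lambda>p q. e p q - e' p q) p q = face2 e p q - face2 e' p q" for p q
    by (cases p; cases q; simp add: face_defs algebra_simps)+
  then show ?thesis using assms by (simp add: entropic_matrix_def)
qed

section \<open>Entropic coboundaries vanish\<close>

text \<open>The second factor's support condition comes from \<open>d\<^sub>1\<close>: choosing \<open>s\<close> with \<open>s * v = t * y\<close> makes
  the first term of that face equal to the entry, while the second one vanishes unless \<open>s = t\<close>.
  Given this, \<open>d\<^sub>0\<close> yields the support condition on the first factor, \<open>d\<^sub>1\<close> the invariance under
  translating the first factor alone, and \<open>d\<^sub>2\<close> the invariance under translating both.\<close>

lemma entropic_matrix_iff:
  "entropic_matrix e \<longleftrightarrow>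
    (\<forall>x y u v. e (x, y) (u, v) \<noteq> 0 \<longrightarrow> (\<forall>t. rop t x = rop t u) \<and> (\<forall>t. rop t y = rop t v)) \<and>
    (\<forall>x y u v t. e (rop x t, y) (rop u t, v) = e (x, y) (u, v)) \<and>
    (\<forall>x y u v t. e (rop x t, rop y t) (rop u t, rop v t) = e (x, y) (u, v))"
  (is "_ \<longleftrightarrow> ?diag \<and> ?fst \<and> ?both")
proof
  assume e: "entropic_matrix e"
  have f0: "e (y, z) (v, w) * (of_bool (rop (rop x y) z = rop (rop u v) w) - of_bool (x = u)) = 0"
    and f1: "e (x, z) (u, w) * of_bool (rop y z = rop v w)
             = e (rop x y, z) (rop u v, w) * of_bool (y = v)"
    and f2: "(e (x, y) (u, v) - e (rop x z, rop y z) (rop u w, rop v w)) * of_bool (z = w) = 0"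
    for x y z u v w
    using e[unfolded entropic_matrix_def, rule_format, of "(x, y, z)" "(u, v, w)"]
    by (auto simp: face_defs)
  have diag: "(\<forall>t. rop t x = rop t u) \<and> (\<forall>t. rop t y = rop t v)" if nz: "e (x, y) (u, v) \<noteq> 0" for x y u v
  proof -
    have yv: "rop t y = rop t v" for t
    proof -
      obtain s where s: "rop s v = rop t y" by (rule right_translation_surj)
      then have "t = s" using f1[of x y u v t s] nz by (cases "t = s") auto
      with s show ?thesis by simp
    qed
    moreover have "rop t x = rop t u" for t
      using f0[of x y u v t t] nz by (cases "rop t x = rop t u") (auto simp: yv)
    ultimately show ?thesis by blast
  qed
  have "e (rop x t, y) (rop u t, v) = e (x, y) (u, v)" for x y u v t
  proof (cases "rop t y = rop t v")
    case True
    then show ?thesis using f1[of x y u v t t] by simp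
  next
    case False
    then have "e (x, y) (u, v) = 0" "e (rop x t, y) (rop u t, v) = 0" using diag by blast+
    then show ?thesis by simp
  qed
  moreover have "e (rop x t, rop y t) (rop u t, rop v t) = e (x, y) (u, v)" for x y u v t
    using f2[of x y u v t t] by simp
  ultimately show "?diag \<and> ?fst \<and> ?both" using diag by blast
next
  assume "?diag \<and> ?fst \<and> ?both"
  then have diag: "\<And>x y u v. e (x, y) (u, v) = 0 \<or> (\<forall>t. rop t x = rop t u) \<and> (\<forall>t. rop t y = rop t v)"
    and fst: "\<And>x y u v t. e (rop x t, y) (rop u t, v) = e (x, y) (u, v)"
    and both: "\<And>x y u v t. e (rop x t, rop y t) (rop u t, rop v t) = e (x, y) (u, v)"
    by blast+
  show "entropic_matrix e" unfolding entropic_matrix_def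
  proof (intro allI)
    fix p q :: "'q \<times> 'q \<times> 'q"
    obtain x y z u v w where pq: "p = (x, y, z)" "q = (u, v, w)" by (metis prod_cases3)
    have "face0 e p q = 0"
      using diag[of y z v w] by (auto simp: pq face_defs)
    moreover have "face1 e p q = 0"
      using diag[of x z u w] fst[of x y z u w] by (cases "y = v") (auto simp: pq face_defs)
    moreover have "face2 e p q = 0"
      using both by (auto simp: pq face_defs)
    ultimately show "face0 e p q = 0 \<and> face1 e p q = 0 \<and> face2 e p q = 0" by blast
  qed
qed

text \<open>Where the entropic coboundary can be nonzero, its first summand vanishes because \<open>y\<close> and \<open>v\<close> act
  alike, so that the entry is \<open>k y x u = a (x * y) (u * y) - a x u\<close> if \<open>y = v\<close>, and zero if not. It is constant
  along \<open>Inn\<close>-orbits, so its sum over the group is the order times \<open>k y x u\<close>, while that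
  sum is a difference of two equal sums.\<close>

lemma entropic_coboundary_zero:
  fixes a :: "'q \<Rightarrow> 'q \<Rightarrow> 'a::comm_ring_1"
  assumes fin: "finite (Inn rop)" and inv: "of_nat (card (Inn rop)) dvd (1::'a)"
    and ent: "entropic_matrix (coboundary a)"
  shows "coboundary a p q = 0"
proof -
  note ent' = ent[unfolded entropic_matrix_iff]
  have diag: "coboundary a (x, y) (u, v) = 0 \<or> (\<forall>t. rop t y = rop t v)" for x y u v
    using ent' by blast
  have fst: "coboundary a (rop x t, y) (rop u t, v) = coboundary a (x, y) (u, v)" for x y u v t
    using ent' by blast
  define k where "k y x u = a (rop x y) (rop u y) - a x u" for x u y
  have cob: "coboundary a (x, y) (u, v) = of_bool (y = v) * k y x u"
    if "\<forall>t. rop t y = rop t v" for x y u v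
    using that by (auto simp: coboundary_def k_def)
  have k_trans: "k y (rop x t) (rop u t) = k y x u" for x t u y
    using fst[of x t y u y] cob[of y y] by simp
  have k_Inn: "k y (g x) (g u) = k y x u" if "g \<in> Inn rop" for g x u y
  proof -
    have "rack_aut g \<and> (\<forall>x u. k y (g x) (g u) = k y x u)"
      using that
    proof (induction rule: Inn_rack_aut_induct)
      case (inv t)
      have "k y (inv_into UNIV (\<lambda>x. rop x t) x) (inv_into UNIV (\<lambda>x. rop x t) u) = k y x u" for x u
        using k_trans[of y "inv_into UNIV (\<lambda>x. rop x t) x" t "inv_into UNIV (\<lambda>x. rop x t) u"]
          surj_f_inv_f[OF bij_is_surj[OF bij_right_translation]] by simp
      then show ?case by blast
    qed (auto simp: k_trans)
    then show ?thesis by blast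
  qed
  have k0: "k y x u = 0" for y x u
  proof -
    obtain r where r: "1 = of_nat (card (Inn rop)) * (r::'a)" using inv by (auto simp: dvd_def)
    have "of_nat (card (Inn rop)) * k y x u = (\<Sum>g\<in>Inn rop. k y (g x) (g u))"
      by (simp add: k_Inn)
    also have "\<dots> = (\<Sum>g\<in>Inn rop. a (rop (g x) y) (rop (g u) y)) - (\<Sum>g\<in>Inn rop. a (g x) (g u))"
      by (simp add: k_def sum_subtractf)
    also have "\<dots> = 0"
      using sum_Inn_left[OF fin, of "\<lambda>g. a (g x) (g u)" y] by simp
    finally have "r * (of_nat (card (Inn rop)) * k y x u) = 0" by simp
    then show ?thesis using r by (metis mult.assoc mult.commute mult_1)
  qed
  obtain x y u v where pq: "p = (x, y)" "q = (u, v)" by (metis surj_pair)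
  show ?thesis using diag[of x y u v] cob[of y v x u] by (auto simp: pq k0)
qed

section \<open>Averaging over the inner group\<close>

lemma cocycleD:
  assumes "cocycle e"
  shows "e (y, z) (v, w) * (of_bool (rop (rop x y) z = rop (rop u v) w) - of_bool (x = u))
     - (e (x, z) (u, w) * of_bool (rop y z = rop v w) - e (rop x y, z) (rop u v, w) * of_bool (y = v))
     + (e (x, y) (u, v) - e (rop x z, rop y z) (rop u w, rop v w)) * of_bool (z = w) = 0"
  using assms[unfolded cocycle_def, rule_format, of "(x, y, z)" "(u, v, w)"]
  by (simp add: face_defs)

lemma cocycle_twist:
  assumes "cocycle e" and g: "rack_aut g"
  shows "cocycle (twist g e)"
  unfolding cocycle_def
proof (intro allI)
  fix p q :: "'q \<times> 'q \<times> 'q"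
  obtain x y z u v w where pq: "p = (x, y, z)" "q = (u, v, w)" by (metis prod_cases3)
  show "face0 (twist g e) p q - face1 (twist g e) p q + face2 (twist g e) p q = 0"
    using cocycleD[OF assms(1), of "g y" "g z" "g v" "g w" "g x" "g u"]
    by (simp add: pq face_defs twist_def rack_aut_eq_iff[OF g] flip: rack_aut_rop[OF g])
qed

lemma cocycle_mult:
  assumes "cocycle e" shows "cocycle (\<lambda>p q. r * e p q)"
proof -
  have "face0 (\<lambda>p q. r * e p q) p q - face1 (\<lambda>p q. r * e p q) p q + face2 (\<lambda>p q. r * e p q) p q
    = r * (face0 e p q - face1 e p q + face2 e p q)" for p q
    by (cases p; cases q) (simp add: face_defs algebra_simps)
  then show ?thesis using assms by (simp add: cocycle_def)
qed

lemma cocycle_sum: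
  assumes "\<And>i. i \<in> I \<Longrightarrow> cocycle (e i)" shows "cocycle (\<lambda>p q. \<Sum>i\<in>I. e i p q)"
  using assms
proof (induction I rule: infinite_finite_induct)
  case (insert i I)
  have "face0 (\<lambda>p q. e p q + e' p q) p q - face1 (\<lambda>p q. e p q + e' p q) p q
      + face2 (\<lambda>p q. e p q + e' p q) p q
    = (face0 e p q - face1 e p q + face2 e p q) + (face0 e' p q - face1 e' p q + face2 e' p q)"
    for e e' :: "'q \<times> 'q \<Rightarrow> 'q \<times> 'q \<Rightarrow> 'b" and p q
    by (cases p; cases q) (simp add: face_defs algebra_simps)
  with insert show ?case by (simp add: cocycle_def)
qed (auto simp: cocycle_def face_defs)

text \<open>This is the cocycle condition on the triples \<open>(x, y, t)\<close> and \<open>(u, v, t)\<close>: the face \<open>d\<^sub>2\<close> compares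
  \<open>e\<close> with its translate, and the other two faces make up the coboundary. So translations act
  trivially on cohomology, with contraction against \<open>t\<close> as the homotopy.\<close>

lemma cocycle_twist_translation:
  assumes "cocycle e"
  shows "twist (\<lambda>x. rop x t) e p q = e p q + coboundary (\<lambda>x u. e (x, t) (u, t)) p q"
proof -
  obtain x y u v where pq: "p = (x, y)" "q = (u, v)" by (metis surj_pair)
  show ?thesis
    using cocycleD[OF assms, of y t v t x u]
    by (cases "y = v") (auto simp: pq twist_def coboundary_def algebra_simps)
qed

text \<open>By induction over words in the translations, since twisting the coboundary of \<open>a\<close> gives the
  coboundary of the twisted \<open>a\<close>.\<close>

lemma cocycle_twist_Inn:
  assumes "g \<in> Inn rop" and ideal: "is_ideal m"
    and e: "cocycle e" and cf: "column_finite e" and m: "entries_in m e"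
  shows "\<exists>a. column_finite a \<and> entries_in m a \<and> (\<forall>p q. twist g e p q = e p q + coboundary a p q)"
    (is "?P g")
proof -
  have "rack_aut g \<and> ?P g"
    using assms(1)
  proof (induction rule: Inn_rack_aut_induct)
    case id
    show ?case
      by (rule exI[of _ "\<lambda>_ _. 0"])
        (simp add: column_finite_def entries_in_def ideal_closed(1)[OF ideal] coboundary_zero twist_def
          map_prod.id)
  next
    case (translation t)
    have "column_finite (\<lambda>x u. e (x, t) (u, t))"
      using column_finite_transport[OF cf, of "\<lambda>u. (u, t)" "\<lambda>x. (x, t)"]
      by (simp add: inj_def)
    then show ?case
      using cocycle_twist_translation[OF e, of t] m by (auto simp: entries_in_def)
  next
    case (inv t)
    let ?i = "inv_into UNIV (\<lambda>x. rop x t)"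
    \<comment> \<open>Untwist the relation for the translation itself.\<close>
    define a where "a x u = - e (?i x, t) (?i u, t)" for x u
    have i: "rop (?i x) t = x" for x
      using surj_f_inv_f[OF bij_is_surj[OF bij_right_translation]] by simp
    have "inj ?i" using rack_aut_inv[OF rack_aut_translation] by (simp add: rack_aut_def bij_def)
    then have "column_finite (\<lambda>x u. - 1 * e (?i x, t) (?i u, t))"
      using column_finite_mult[OF column_finite_transport[OF cf, of "\<lambda>u. (?i u, t)" "\<lambda>x. (?i x, t)"],
          of "- 1"]
      by (simp add: inj_def)
    then have "column_finite a" by (simp add: a_def[abs_def])
    moreover have "entries_in m a"
      using m ideal by (simp add: a_def entries_in_def ideal_closed)
    moreover have "twist ?i e p q = e p q + coboundary a p q" for p q
    proof -
      have "twist (\<lambda>x. rop x t) e (map_prod ?i ?i p) (map_prod ?i ?i q)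
        = twist ?i e p q + twist ?i (coboundary (\<lambda>x u. e (x, t) (u, t))) p q"
        unfolding twist_def[of ?i] by (rule cocycle_twist_translation[OF e])
      moreover have "twist (\<lambda>x. rop x t) e (map_prod ?i ?i p) (map_prod ?i ?i q) = e p q"
        by (cases p; cases q) (simp add: twist_def i)
      moreover have "twist ?i (coboundary (\<lambda>x u. e (x, t) (u, t))) p q = - coboundary a p q"
        using coboundary_mult[of "-1" "\<lambda>x u. e (?i x, t) (?i u, t)" p q]
        by (simp add: coboundary_twist rack_aut_inv rack_aut_translation a_def[abs_def])
      ultimately show ?thesis by simp
    qed
    ultimately show ?case by blast
  next
    case (comp g h)
    obtain a where a: "column_finite a" "entries_in m a"
        "\<forall>p q. twist g e p q = e p q + coboundary a p q"
      using comp(3) by (elim exE conjE)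
    obtain b where b: "column_finite b" "entries_in m b"
        "\<forall>p q. twist h e p q = e p q + coboundary b p q"
      using comp(4) by (elim exE conjE)
    let ?c = "\<lambda>x u. b x u + a (h x) (h u)"
    have "column_finite ?c"
      using \<open>rack_aut h\<close>
      by (intro column_finite_add[OF b(1)] column_finite_transport[OF a(1)])
        (simp add: rack_aut_def bij_def)
    moreover have "entries_in m ?c"
      using a(2) b(2) ideal by (simp add: entries_in_def ideal_closed)
    moreover have "twist (g \<circ> h) e p q = e p q + coboundary ?c p q" for p q
    proof -
      have "twist (g \<circ> h) e p q = twist g e (map_prod h h p) (map_prod h h q)"
        by (cases p; cases q) (simp add: twist_def)
      also have "\<dots> = twist h e p q + twist h (coboundary a) p q"
        unfolding twist_def[of h] by (rule a(3)[rule_format])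
      also have "\<dots> = e p q + coboundary ?c p q"
        by (simp add: b(3) coboundary_twist \<open>rack_aut h\<close> coboundary_add)
      finally show ?thesis .
    qed
    ultimately show ?case by blast
  qed
  then show ?thesis by blast
qed

text \<open>The mean of the twists of \<open>e\<close> over \<open>Inn\<close> is \<open>e\<close> plus the coboundary of the mean of the cochains
  supplied by \<open>cocycle_twist_Inn\<close>.\<close>

lemma cocycle_average:
  fixes e :: "'q \<times> 'q \<Rightarrow> 'q \<times> 'q \<Rightarrow> 'a::comm_ring_1"
  assumes fin: "finite (Inn rop)" and inv: "of_nat (card (Inn rop)) dvd (1::'a)"
    and m: "is_ideal m" and e: "cocycle e" "column_finite e" "entries_in m e"
  obtains a e' where "column_finite a" "entries_in m a" "cocycle e'" "column_finite e'"
    "entries_in m e'" "\<And>p q. e' p q = e p q + coboundary a p q"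
    "\<And>t p q. twist (\<lambda>x. rop x t) e' p q = e' p q"
proof -
  obtain r where r: "of_nat (card (Inn rop)) * (r::'a) = 1" using inv by (auto simp: dvd_def)
  have "\<forall>g\<in>Inn rop. \<exists>a. column_finite a \<and> entries_in m a \<and>
      (\<forall>p q. twist g e p q = e p q + coboundary a p q)"
    using cocycle_twist_Inn[OF _ m e] by blast
  then obtain b where b: "\<And>g. g \<in> Inn rop \<Longrightarrow> column_finite (b g)"
      "\<And>g. g \<in> Inn rop \<Longrightarrow> entries_in m (b g)"
      "\<And>g p q. g \<in> Inn rop \<Longrightarrow> twist g e p q = e p q + coboundary (b g) p q"
    by metis
  define a where "a x u = r * (\<Sum>g\<in>Inn rop. b g x u)" for x u
  define e' where "e' p q = r * (\<Sum>g\<in>Inn rop. twist g e p q)" for p q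
  show ?thesis
  proof
    show "column_finite a"
      unfolding a_def[abs_def] by (intro column_finite_mult column_finite_sum b)
    show "entries_in m a"
      using b(2) by (auto simp: a_def entries_in_def intro!: ideal_closed(3)[OF m] ideal_sum[OF m])
    show "cocycle e'"
      unfolding e'_def[abs_def] by (intro cocycle_mult cocycle_sum cocycle_twist e Inn_rack_aut)
    show "column_finite e'"
      unfolding e'_def[abs_def] twist_def
      by (intro column_finite_mult column_finite_sum column_finite_transport[OF e(2)] prod.inj_map)
        (auto dest: Inn_rack_aut simp: rack_aut_def bij_def)
    show "entries_in m e'"
      using e(3) by (auto simp: e'_def twist_def entries_in_def intro!: ideal_closed(3)[OF m] ideal_sum[OF m])
    show "e' p q = e p q + coboundary a p q" for p q
    proof -
      have "e' p q = r * (of_nat (card (Inn rop)) * e p q + (\<Sum>g\<in>Inn rop. coboundary (b g) p q))"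
        by (simp add: e'_def b(3) sum.distrib)
      also have "\<dots> = (of_nat (card (Inn rop)) * r) * e p q + coboundary a p q"
        by (simp add: a_def[abs_def] coboundary_mult coboundary_sum algebra_simps)
      finally show ?thesis by (simp add: r)
    qed
    show "twist (\<lambda>x. rop x t) e' p q = e' p q" for t p q
      using sum_Inn_right[OF fin, of "\<lambda>g. twist g e p q" t]
      by (cases p; cases q) (simp add: e'_def twist_def)
  qed
qed

section \<open>Invariant cocycles are cohomologous to entropic ones\<close>

text \<open>The hypotheses on \<open>y\<close> and \<open>v\<close> force \<open>z \<noteq> w\<close>, so on the triples \<open>(x, y, z)\<close> and \<open>(u, v, w)\<close> only
  \<open>d\<^sub>0\<close> and one term of \<open>d\<^sub>1\<close> survive. The dependence on \<open>x\<close> and \<open>u\<close> is that of the coboundary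
  of a cochain with value \<open>e (y, z) (v, w)\<close> at \<open>(z, w)\<close>; with \<open>x\<close> and \<open>u\<close> suitably chosen this also
  shows that the value does not depend on the choice of \<open>y\<close> and \<open>v\<close>.\<close>

lemma cocycle_off_diagonal:
  assumes e: "cocycle e" and yv: "y \<noteq> v" "rop y z = rop v w"
  shows "e (x, z) (u, w) = e (y, z) (v, w) * (of_bool (rop x z = rop u w) - of_bool (x = u))"
proof -
  have "z \<noteq> w" using yv by auto
  moreover have "rop (rop x y) z = rop (rop u v) w \<longleftrightarrow> rop x z = rop u w"
    using yv(2) by (simp add: self_distrib[of x y z] self_distrib[of u v w])
  ultimately show ?thesis
    using cocycleD[OF e, of y z v w x u] yv by simp
qed

text \<open>When \<open>z\<close> and \<open>w\<close> act alike, the factor \<open>y * z = v * w\<close> in \<open>d\<^sub>1\<close> becomes \<open>y = v\<close>. Taking \<open>y = v\<close> or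
  \<open>y \<noteq> v\<close> then separates the two conditions. The support condition follows from the case where the
  other pair is \<open>(t, t)\<close> for an element \<open>t\<close> on which the two translations differ.\<close>

lemma equivariant_cocycle_diagonal:
  assumes e: "cocycle e" and equi: "\<And>t p q. twist (\<lambda>x. rop x t) e p q = e p q"
    and zw: "\<And>t. rop t z = rop t w"
  shows "e (x, z) (u, w) = 0 \<or> (\<forall>t. rop t x = rop t u)"
    and "e (rop x t, z) (rop u t, w) = e (x, z) (u, w)"
proof -
  have "e (rop x t, rop y t) (rop u t, rop v t) = e (x, y) (u, v)" for x y u v t
    using equi[of t "(x, y)" "(u, v)"] by (simp add: twist_def)
  then have *: "e (y, z) (v, w) * (of_bool (rop x y = rop u v) - of_bool (x = u))
    = (e (x, z) (u, w) - e (rop x y, z) (rop u v, w)) * of_bool (y = v)" for x y u v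
    using cocycleD[OF e, of y z v w x u] by (auto simp: zw split: if_splits)
  show "e (x, z) (u, w) = 0 \<or> (\<forall>t. rop t x = rop t u)"
  proof (rule disjCI)
    assume "\<not> (\<forall>t. rop t x = rop t u)"
    then obtain t where t: "rop t x \<noteq> rop t u" by blast
    then show "e (x, z) (u, w) = 0" using *[of x u t t] by (cases "x = u") auto
  qed
  show "e (rop x t, z) (rop u t, w) = e (x, z) (u, w)"
    using *[of t t x u] by simp
qed

text \<open>If \<open>z\<close> and \<open>w\<close> act differently there are \<open>y \<noteq> v\<close> with \<open>y * z = v * w\<close>, and the entries of \<open>e\<close> at
  \<open>(z, w)\<close> are cancelled by the coboundary of \<open>a z w = - e (y, z) (v, w)\<close>. The value \<open>a z w\<close> does not
  depend on the choice of \<open>y\<close> and \<open>v\<close>, which makes \<open>a\<close> invariant and kills the remaining terms of its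
  coboundary.\<close>

lemma equivariant_cocycle_entropic:
  fixes e :: "'q \<times> 'q \<Rightarrow> 'q \<times> 'q \<Rightarrow> 'a::comm_ring_1"
  assumes fin: "finite (Inn rop)" and m: "is_ideal m"
    and e: "cocycle e" "column_finite e" "entries_in m e"
    and equi: "\<And>t p q. twist (\<lambda>x. rop x t) e p q = e p q"
  obtains a where "column_finite a" "entries_in m a"
    "entropic_matrix (\<lambda>p q. e p q + coboundary a p q)"
proof -
  \<comment> \<open>\<open>y\<close> may depend on \<open>w\<close> only through its translation \<open>r\<close>. There are finitely many of these, so each
      column of \<open>a\<close> is assembled from finitely many columns of \<open>e\<close> and is finite.\<close>
  define Y where "Y z r = (SOME y. rop y z \<noteq> r y)" for z r
  define V where "V z r = inv_into UNIV r (rop (Y z r) z)" for z r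
  have YV: "Y z (\<lambda>t. rop t w) \<noteq> V z (\<lambda>t. rop t w)"
      "rop (Y z (\<lambda>t. rop t w)) z = rop (V z (\<lambda>t. rop t w)) w"
    if "\<not> (\<forall>t. rop t z = rop t w)" for z w
  proof -
    show *: "rop (Y z (\<lambda>t. rop t w)) z = rop (V z (\<lambda>t. rop t w)) w"
      using surj_f_inv_f[OF bij_is_surj[OF bij_right_translation[of w]]] by (simp add: V_def)
    have "rop (Y z (\<lambda>t. rop t w)) z \<noteq> rop (Y z (\<lambda>t. rop t w)) w"
      unfolding Y_def by (rule someI_ex) (use that in blast)
    then show "Y z (\<lambda>t. rop t w) \<noteq> V z (\<lambda>t. rop t w)" using * by metis
  qed
  define a where "a z w = (if \<forall>t. rop t z = rop t w then 0
    else - e (Y z (\<lambda>t. rop t w), z) (V z (\<lambda>t. rop t w), w))" for z w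
  have a_zero: "a z w = 0" if "\<forall>t. rop t z = rop t w" for z w
    using that by (simp add: a_def)
  have off: "e (x, z) (u, w) = - a z w * (of_bool (rop x z = rop u w) - of_bool (x = u))"
    if "\<not> (\<forall>t. rop t z = rop t w)" for x z u w
    using cocycle_off_diagonal[OF e(1) YV[OF that], where x = x and u = u] that by (simp add: a_def)
  have a_equi: "a (rop z t) (rop w t) = a z w" for z w t
  proof -
    have iff: "(\<forall>s. rop s (rop z t) = rop s (rop w t)) \<longleftrightarrow> (\<forall>s. rop s z = rop s w)"
    proof -
      have "(\<forall>s. rop s (rop z t) = rop s (rop w t)) \<longleftrightarrow>
        (\<forall>s. rop (rop s t) (rop z t) = rop (rop s t) (rop w t))"
        by (metis right_translation_surj)
      then show ?thesis by (simp flip: self_distrib)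
    qed
    show ?thesis
    proof (cases "\<forall>s. rop s z = rop s w")
      case True
      then show ?thesis using iff a_zero by simp
    next
      case False
      let ?y = "Y z (\<lambda>t. rop t w)" and ?v = "V z (\<lambda>t. rop t w)"
      note yv = YV[OF False]
      have "\<not> (\<forall>s. rop s (rop z t) = rop s (rop w t))" using False iff by blast
      \<comment> \<open>The translated \<open>y\<close> and \<open>v\<close> are admissible for the translated \<open>z\<close> and \<open>w\<close>, although they need
          not be the chosen ones.\<close>
      then have "e (rop ?y t, rop z t) (rop ?v t, rop w t) = - a (rop z t) (rop w t)"
        using off[of "rop z t" "rop w t" "rop ?y t" "rop ?v t"] yv by (simp flip: self_distrib)
      moreover have "e (rop ?y t, rop z t) (rop ?v t, rop w t) = e (?y, z) (?v, w)"
        using equi[of t "(?y, z)" "(?v, w)"] by (simp add: twist_def)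
      moreover have "a z w = - e (?y, z) (?v, w)"
        unfolding a_def using False by (rule if_not_P)
      ultimately show ?thesis by simp
    qed
  qed
  show ?thesis
  proof
    show "column_finite a"
      unfolding column_finite_def
    proof
      fix z
      have "{w. a z w \<noteq> 0} \<subseteq> (\<Union>r\<in>Inn rop. snd ` {q. e (Y z r, z) q \<noteq> 0})"
      proof
        fix w assume "w \<in> {w. a z w \<noteq> 0}"
        then have "e (Y z (\<lambda>t. rop t w), z) (V z (\<lambda>t. rop t w), w) \<noteq> 0"
          by (auto simp: a_def split: if_splits)
        then show "w \<in> (\<Union>r\<in>Inn rop. snd ` {q. e (Y z r, z) q \<noteq> 0})"
          using translation_in_Inn[of w] by (intro UN_I) (auto simp: image_iff intro!: exI)
      qed
      moreover have "finite \<dots>" using fin e(2) by (auto simp: column_finite_def)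
      ultimately show "finite {w. a z w \<noteq> 0}" by (rule finite_subset)
    qed
    show "entries_in m a"
      using e(3) m by (auto simp: entries_in_def a_def ideal_closed)
    have cob: "coboundary a (x, z) (u, w) = a z w * (of_bool (rop x z = rop u w) - of_bool (x = u))"
      for x z u w by (auto simp: coboundary_def a_equi)
    let ?e = "\<lambda>p q. e p q + coboundary a p q"
    have e_off: "?e (x, z) (u, w) = 0" if "\<not> (\<forall>t. rop t z = rop t w)" for x z u w
      using off[OF that, of x u] by (simp add: cob)
    have e_diag: "?e (x, z) (u, w) = e (x, z) (u, w)" if "\<forall>t. rop t z = rop t w" for x z u w
      using that by (simp add: cob a_zero)
    have both: "?e (rop x t, rop y t) (rop u t, rop v t) = ?e (x, y) (u, v)" for x y u v t
      using equi[of t "(x, y)" "(u, v)"] by (simp add: twist_def cob a_equi flip: self_distrib)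
    show "entropic_matrix ?e"
      unfolding entropic_matrix_iff
    proof (intro conjI allI impI)
      fix x y u v assume nz: "?e (x, y) (u, v) \<noteq> 0"
      then have "\<forall>t. rop t y = rop t v" using e_off by blast
      then show "rop t x = rop t u" and "rop t y = rop t v" for t
        using nz equivariant_cocycle_diagonal(1)[OF e(1) equi, of y v x u] e_diag by auto
    next
      fix x y u v t
      show "?e (rop x t, y) (rop u t, v) = ?e (x, y) (u, v)"
      proof (cases "\<forall>t. rop t y = rop t v")
        case True
        then show ?thesis
          using equivariant_cocycle_diagonal(2)[OF e(1) equi, of y v x t u] e_diag by auto
      next
        case False
        show ?thesis by (simp only: e_off[OF False])
      qed
    qed (simp_all only: both)
  qed
qed

lemma cocycle_cohomologous_entropic:
  fixes e :: "'q \<times> 'q \<Rightarrow> 'q \<times> 'q \<Rightarrow> 'a::comm_ring_1"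
  assumes "finite (Inn rop)" and "of_nat (card (Inn rop)) dvd (1::'a)"
    and m: "is_ideal m" and "cocycle e" "column_finite e" "entries_in m e"
  obtains a where "column_finite a" "entries_in m a"
    "entropic_matrix (\<lambda>p q. e p q + coboundary a p q)"
proof -
  obtain a e' where a: "column_finite a" "entries_in m a" "\<And>p q. e' p q = e p q + coboundary a p q"
    and e': "cocycle e'" "column_finite e'" "entries_in m e'"
      "\<And>t p q. twist (\<lambda>x. rop x t) e' p q = e' p q"
    using cocycle_average[OF assms] by metis
  obtain b where b: "column_finite b" "entries_in m b"
    "entropic_matrix (\<lambda>p q. e' p q + coboundary b p q)"
    using equivariant_cocycle_entropic[OF assms(1) m e'] by metis
  show ?thesis
  proof
    show "column_finite (\<lambda>x u. a x u + b x u)" using a b by (intro column_finite_add)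
    show "entries_in m (\<lambda>x u. a x u + b x u)"
      using a b m by (simp add: entries_in_def ideal_closed)
    show "entropic_matrix (\<lambda>p q. e p q + coboundary (\<lambda>x u. a x u + b x u) p q)"
      using b(3) by (simp add: coboundary_add a(3) add.assoc)
  qed
qed

end

section \<open>Linear maps of free modules and their matrices\<close>

abbreviation lookup where "lookup \<equiv> Poly_Mapping.lookup"

definition entry :: "(('x \<Rightarrow>\<^sub>0 'a::comm_ring_1) \<Rightarrow> ('y \<Rightarrow>\<^sub>0 'a)) \<Rightarrow> 'x \<Rightarrow> 'y \<Rightarrow> 'a" where
  "entry f p q = lookup (f (basis p)) q"

definition kron :: "'x \<Rightarrow> 'x \<Rightarrow> 'a::comm_ring_1" where
  "kron p q = of_bool (p = q)"

lemma kron_Pair: "kron (x, y) (u, v) = kron x u * kron y v"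
  by (simp add: kron_def of_bool_conj)

lemma lookup_basis: "lookup (basis p) q = (kron p q :: 'a::comm_ring_1)"
  by (simp add: kron_def lookup_single when_def)

lemma lookup_lin_ext_superset:
  assumes "finite S" and "Poly_Mapping.keys v \<subseteq> S"
  shows "lookup (lin_ext g v) k = (\<Sum>x\<in>S. lookup v x * lookup (g x) k)"
  unfolding lin_ext_def lookup_sum lookup_scal
  by (rule sum.mono_neutral_left) (use assms in \<open>auto simp: in_keys_iff\<close>)

lemma lin_ext_basis [simp]: "lin_ext g (basis p) = g p"
  by (rule poly_mapping_eqI) (subst lookup_lin_ext_superset[of "{p}"], auto)

lemma lin_lin_ext: "lin (lin_ext g)"
proof -
  have "lin_ext g (v + w) = lin_ext g v + lin_ext g w" for v w
  proof (rule poly_mapping_eqI)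
    fix k
    let ?S = "Poly_Mapping.keys v \<union> Poly_Mapping.keys w \<union> Poly_Mapping.keys (v + w)"
    show "lookup (lin_ext g (v + w)) k = lookup (lin_ext g v + lin_ext g w) k"
      using lookup_lin_ext_superset[of ?S v g k] lookup_lin_ext_superset[of ?S w g k]
        lookup_lin_ext_superset[of ?S "v + w" g k]
      by (simp add: lookup_add sum.distrib algebra_simps Un_commute Un_left_commute subset_iff)
  qed
  moreover have "lin_ext g (scal r v) = scal r (lin_ext g v)" for r v
  proof (rule poly_mapping_eqI)
    fix k
    let ?S = "Poly_Mapping.keys v \<union> Poly_Mapping.keys (scal r v)"
    show "lookup (lin_ext g (scal r v)) k = lookup (scal r (lin_ext g v)) k"
      using lookup_lin_ext_superset[of ?S v g k] lookup_lin_ext_superset[of ?S "scal r v" g k]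
      by (simp add: sum_distrib_left mult.assoc)
  qed
  ultimately show ?thesis by (simp add: module_hom_iff module_scal)
qed

lemma lookup_lin:
  assumes "lin f"
  shows "lookup (f v) k = (\<Sum>p\<in>Poly_Mapping.keys v. lookup v p * entry f p k)"
proof -
  interpret module_hom scal scal f by fact
  have v: "v = (\<Sum>p\<in>Poly_Mapping.keys v. scal (lookup v p) (basis p))"
  proof (rule poly_mapping_eqI)
    fix k
    have "lookup (\<Sum>p\<in>Poly_Mapping.keys v. scal (lookup v p) (basis p)) k
      = (\<Sum>p\<in>Poly_Mapping.keys v. if p = k then lookup v p else 0)"
      by (simp add: lookup_sum lookup_single when_def if_distrib cong: if_cong)
    also have "\<dots> = lookup v k" by (simp add: in_keys_iff)
    finally show "lookup v k = lookup (\<Sum>p\<in>Poly_Mapping.keys v. scal (lookup v p) (basis p)) k" ..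
  qed
  have "f v = (\<Sum>p\<in>Poly_Mapping.keys v. scal (lookup v p) (f (basis p)))"
    by (subst v) (simp add: sum scale)
  then show ?thesis by (simp add: lookup_sum entry_def)
qed

lemma lin_eqI:
  assumes "lin f" and "lin g" and "\<And>p q. entry f p q = entry g p q"
  shows "f = g"
  by (rule ext, rule poly_mapping_eqI) (simp add: lookup_lin assms)

lemma lin_eq_iff:
  assumes "lin f" and "lin g"
  shows "f = g \<longleftrightarrow> (\<forall>p q. entry f p q = entry g p q)"
  using lin_eqI[OF assms] by blast

lemma lin_comp: "lin f \<Longrightarrow> lin g \<Longrightarrow> lin (f \<circ> g)"
  by (rule module_hom_compose)

lemma lin_add: "lin f \<Longrightarrow> lin g \<Longrightarrow> lin (\<lambda>v. f v + g v)"
  by (simp add: module_hom_iff module.scale_right_distrib)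

lemma lin_diff: "lin f \<Longrightarrow> lin g \<Longrightarrow> lin (\<lambda>v. f v - g v)"
  by (simp add: module_hom_iff module.scale_right_diff_distrib)

lemma lin_id: "lin id"
  using module.module_hom_id[OF module_scal] .

lemma entry_id: "entry id p q = kron p q"
  by (simp add: entry_def lookup_basis)

lemma column_finite_entry: "column_finite (entry f)"
  by (simp add: column_finite_def entry_def)

lemma column_finite_kron: "column_finite kron"
  by (simp add: column_finite_def kron_def)

lemma lin_of_matrix:
  assumes "column_finite M"
  obtains f where "lin f" "\<And>p q. entry f p q = M p q"
proof
  show "lin (lin_ext (\<lambda>p. Abs_poly_mapping (M p)))" by (rule lin_lin_ext)
  show "entry (lin_ext (\<lambda>p. Abs_poly_mapping (M p))) p q = M p q" for p q
    using assms by (simp add: entry_def column_finite_def)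
qed

definition perm_map :: "('x \<Rightarrow> 'x) \<Rightarrow> ('x \<Rightarrow>\<^sub>0 'a::comm_ring_1) \<Rightarrow> ('x \<Rightarrow>\<^sub>0 'a)" where
  "perm_map s = lin_ext (\<lambda>x. basis (s x))"

lemma lin_perm_map: "lin (perm_map s)"
  by (simp add: perm_map_def lin_lin_ext)

lemma perm_map_basis [simp]: "perm_map s (basis x) = basis (s x)"
  by (simp add: perm_map_def)

lemma perm_map_comp: "perm_map s \<circ> perm_map t = perm_map (s \<circ> t)"
  by (rule lin_eqI) (simp_all add: lin_comp lin_perm_map entry_def)

lemma perm_map_id: "perm_map id = id"
  by (rule lin_eqI) (simp_all add: lin_perm_map lin_id entry_def)

lemma perm_map_inverse:
  assumes "bij s"
  shows "perm_map (inv_into UNIV s) \<circ> perm_map s = id" "perm_map s \<circ> perm_map (inv_into UNIV s) = id"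
  using assms by (simp_all add: perm_map_comp perm_map_id bij_is_inj surj_iff[THEN iffD1, OF bij_is_surj])

lemma bij_perm_map: "bij s \<Longrightarrow> bij (perm_map s)"
  by (rule o_bij[OF perm_map_inverse])

lemma inv_perm_map: "bij s \<Longrightarrow> inv_into UNIV (perm_map s) = perm_map (inv_into UNIV s)"
  by (rule inv_unique_comp[OF perm_map_inverse(2) perm_map_inverse(1)])

text \<open>Injectivity of \<open>r\<close> rules out collisions of basis vectors, so coefficients are carried along.\<close>

lemma lookup_lin_relabel:
  assumes "lin F" and "\<And>p. F (basis p) = basis (r p)" and "inj r"
  shows "lookup (F v) (r k) = lookup v k"
proof -
  have e: "entry F p (r k) = of_bool (p = k)" for p
    using assms(2,3) by (simp add: entry_def lookup_single when_def inj_eq)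
  then have "lookup (F v) (r k) = (\<Sum>p\<in>Poly_Mapping.keys v. if p = k then lookup v p else 0)"
    by (simp add: lookup_lin[OF assms(1)] e of_bool_def if_distrib cong: if_cong)
  also have "\<dots> = lookup v k" by (simp add: in_keys_iff)
  finally show ?thesis .
qed

lemma lookup_perm_map: "inj s \<Longrightarrow> lookup (perm_map s v) (s k) = lookup v k"
  by (rule lookup_lin_relabel[OF lin_perm_map perm_map_basis])

definition conj_perm :: "('x \<Rightarrow> 'x) \<Rightarrow> (('x \<Rightarrow>\<^sub>0 'a::comm_ring_1) \<Rightarrow> ('x \<Rightarrow>\<^sub>0 'a)) \<Rightarrow> (('x \<Rightarrow>\<^sub>0 'a) \<Rightarrow> ('x \<Rightarrow>\<^sub>0 'a))"
  where "conj_perm s f = perm_map (inv_into UNIV s) \<circ> f \<circ> perm_map s"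

lemma lin_conj_perm: "lin f \<Longrightarrow> lin (conj_perm s f)"
  by (simp add: conj_perm_def lin_comp lin_perm_map)

lemma entry_conj_perm:
  assumes "bij s" shows "entry (conj_perm s f) p q = entry f (s p) (s q)"
proof -
  have "inj (inv_into UNIV s)" using assms by (simp add: bij_imp_bij_inv bij_is_inj)
  from lookup_perm_map[OF this, of "f (basis (s p))" "s q"] show ?thesis
    using assms by (simp add: entry_def conj_perm_def bij_is_inj)
qed

lemma perm_map_conj_perm: "bij s \<Longrightarrow> perm_map s \<circ> conj_perm s f = f \<circ> perm_map s"
  by (simp add: conj_perm_def comp_assoc[symmetric] perm_map_inverse(2))

lemma perm_map_cancel: "bij s \<Longrightarrow> perm_map s \<circ> f = perm_map s \<circ> g \<longleftrightarrow> f = g"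
  by (simp add: fun_eq_iff inj_eq[OF bij_is_inj[OF bij_perm_map]])

section \<open>Maps congruent to the identity modulo a square-zero ideal\<close>

definition unipotent :: "'a set \<Rightarrow> (('x \<Rightarrow>\<^sub>0 'a::comm_ring_1) \<Rightarrow> ('x \<Rightarrow>\<^sub>0 'a)) \<Rightarrow> bool" where
  "unipotent m f \<longleftrightarrow> lin f \<and> cong_mod m f id"

definition deviation :: "(('x \<Rightarrow>\<^sub>0 'a::comm_ring_1) \<Rightarrow> ('x \<Rightarrow>\<^sub>0 'a)) \<Rightarrow> 'x \<Rightarrow> 'x \<Rightarrow> 'a" where
  "deviation f p q = entry f p q - kron p q"

lemma column_finite_deviation: "column_finite (deviation f)"
  using column_finite_add[OF column_finite_entry column_finite_mult[OF column_finite_kron, of "-1"], of f]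
  by (simp add: deviation_def[abs_def])

text \<open>It suffices to test congruence on basis vectors, since \<open>m\<close> is closed under linear combinations.\<close>

lemma unipotent_iff:
  assumes "is_ideal m" and "lin f"
  shows "unipotent m f \<longleftrightarrow> entries_in m (deviation f)"
proof
  assume u: "unipotent m f"
  have "lookup (f (basis p) - basis p) q \<in> m" for p q
    using u unfolding unipotent_def cong_mod_def by (metis id_apply)
  then show "entries_in m (deviation f)"
    by (simp add: entries_in_def deviation_def entry_def lookup_minus lookup_basis)
next
  assume *: "entries_in m (deviation f)"
  have "lookup (f v - id v) k \<in> m" for v k
  proof -
    have "lookup (f v - id v) k = (\<Sum>p\<in>Poly_Mapping.keys v. lookup v p * deviation f p k)"
      by (simp add: lookup_minus lookup_lin[OF assms(2)] lookup_lin[OF lin_id, of v k, simplified]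
          entry_id deviation_def sum_subtractf algebra_simps)
    also have "\<dots> \<in> m"
      using * by (auto simp: entries_in_def intro!: ideal_sum assms(1) ideal_closed(3)[OF assms(1)])
    finally show ?thesis .
  qed
  then show "unipotent m f" by (simp add: unipotent_def cong_mod_def assms(2))
qed

lemma unipotent_lin: "unipotent m f \<Longrightarrow> lin f" by (simp add: unipotent_def)

text \<open>The linearization principle behind the whole proof: \<open>f - id\<close> multiplies coefficients by elements
  of \<open>m\<close>, so it kills \<open>g v - v\<close>, whose coefficients already lie in \<open>m\<close>.\<close>

lemma unipotent_comp:
  assumes m: "is_ideal m" "square_zero m" and f: "unipotent m f" and g: "unipotent m g"
  shows "f (g v) = f v + g v - v"
proof -
  interpret module_hom scal scal f using f by (simp add: unipotent_def)
  have gv: "lookup (g v - v) p \<in> m" for p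
    using g by (metis cong_mod_def id_apply unipotent_def)
  have "lookup (f (g v - v) - (g v - v)) k = 0" for k
  proof -
    have "lookup (f (g v - v) - (g v - v)) k
      = (\<Sum>p\<in>Poly_Mapping.keys (g v - v). lookup (g v - v) p * deviation f p k)"
      using lookup_lin[OF lin_id, of "g v - v" k]
      by (simp add: lookup_minus[of "f (g v - v)"] lookup_lin[OF unipotent_lin[OF f], of "g v - v"]
          entry_id deviation_def sum_subtractf right_diff_distrib)
    also have "\<dots> = 0"
      using m(2) gv f unipotent_iff[OF m(1) unipotent_lin[OF f]]
      by (intro sum.neutral) (simp add: square_zero_def entries_in_def)
    finally show ?thesis .
  qed
  then have "f (g v - v) - (g v - v) = 0" by (intro poly_mapping_eqI) simp
  then show ?thesis by (simp add: diff algebra_simps)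
qed

lemma entry_unipotent_comp:
  assumes "is_ideal m" "square_zero m" "unipotent m f" "unipotent m g"
  shows "entry (f \<circ> g) p q = entry f p q + entry g p q - kron p q"
  by (simp add: entry_def unipotent_comp[OF assms] lookup_add lookup_minus lookup_basis)

text \<open>The inverse of \<open>id + e\<close> is \<open>id - e\<close>, because \<open>e \<circ> e = 0\<close>.\<close>

lemma unipotent_inverse:
  assumes m: "is_ideal m" "square_zero m" and f: "unipotent m f"
  obtains g where "unipotent m g" "f \<circ> g = id" "g \<circ> f = id"
proof
  let ?g = "\<lambda>v. v + v - f v"
  have "lin ?g"
    by (intro lin_diff lin_add unipotent_lin[OF f] module.module_hom_ident[OF module_scal])
  moreover have "deviation ?g p q = - deviation f p q" for p q
    by (simp add: deviation_def entry_def lookup_minus lookup_add lookup_basis)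
  ultimately show g: "unipotent m ?g"
    using f m(1) unipotent_iff[OF m(1), of f] unipotent_iff[OF m(1), of ?g]
    by (simp add: entries_in_def ideal_closed unipotent_def)
  show "f \<circ> ?g = id" using unipotent_comp[OF m f g] by (simp add: fun_eq_iff)
  show "?g \<circ> f = id" using unipotent_comp[OF m g f] by (simp add: fun_eq_iff)
qed

lemma unipotent_bij:
  assumes "is_ideal m" "square_zero m" "unipotent m f" shows "bij f"
  using unipotent_inverse[OF assms] by (metis o_bij)

lemma unipotent_conj_perm:
  assumes "is_ideal m" and "bij s" and "unipotent m f"
  shows "unipotent m (conj_perm s f)"
proof -
  have "deviation (conj_perm s f) p q = deviation f (s p) (s q)" for p q
    using assms(2) by (simp add: deviation_def entry_conj_perm kron_def bij_is_inj inj_eq)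
  then show ?thesis
    using assms unipotent_iff[OF assms(1), of f] unipotent_iff[OF assms(1), of "conj_perm s f"]
    by (simp add: entries_in_def unipotent_lin lin_conj_perm)
qed

section \<open>Tensor products and strands\<close>

lemma lookup_tensor_vec: "lookup (tensor_vec v w) (x, y) = lookup v x * lookup w y"
proof -
  have "lookup (tensor_vec v w) (x, y) = (\<Sum>x'\<in>Poly_Mapping.keys v. \<Sum>y'\<in>Poly_Mapping.keys w.
     if y' = y then if x' = x then lookup v x' * lookup w y' else 0 else 0)"
    by (auto simp: tensor_vec_def lookup_sum lookup_single when_def intro!: sum.cong)
  also have "\<dots> = (\<Sum>x'\<in>Poly_Mapping.keys v. if x' = x then lookup v x' * lookup w y else 0)"
    by (intro sum.cong) (auto simp: in_keys_iff)
  also have "\<dots> = lookup v x * lookup w y" by (auto simp: in_keys_iff)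
  finally show ?thesis .
qed

lemma lin_tensor_map: "lin (tensor_map f g)"
  by (simp add: tensor_map_def lin_lin_ext)

lemma entry_tensor_map: "entry (tensor_map f g) (x, y) (u, v) = entry f x u * entry g y v"
  by (simp add: entry_def tensor_map_def lookup_tensor_vec)

lemma lin_strand12: "lin (strand12 f)"
  unfolding strand12_def assoc_def unassoc_def by (intro lin_comp lin_lin_ext lin_tensor_map)

lemma lookup_assoc: "lookup (assoc v) (x, y, z) = lookup v ((x, y), z)"
  using lookup_lin_relabel[of assoc "\<lambda>((x, y), z). (x, y, z)" v "((x, y), z)"]
  by (auto simp: assoc_def lin_lin_ext inj_def case_prod_unfold)

lemma entry_strand12:
  "entry (strand12 f) (x, y, z) (u, v, w) = entry f (x, y) (u, v) * kron z w"
proof -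
  have "entry (strand12 f) (x, y, z) (u, v, w) = entry (tensor_map f id) ((x, y), z) ((u, v), w)"
    by (simp add: entry_def strand12_def unassoc_def lookup_assoc)
  then show ?thesis by (simp add: entry_tensor_map entry_id)
qed

lemma lin_strand23: "lin (strand23 f)"
  by (simp add: strand23_def lin_tensor_map)

lemma entry_strand23:
  "entry (strand23 f) (x, y, z) (u, v, w) = kron x u * entry f (y, z) (v, w)"
  by (simp add: strand23_def entry_tensor_map entry_id)

lemma unipotent_strand:
  assumes m: "is_ideal m" and f: "unipotent m f"
  shows "unipotent m (strand12 f)" and "unipotent m (strand23 f)"
proof -
  have e: "entries_in m (deviation f)" using f unipotent_iff[OF m unipotent_lin[OF f]] by blast
  have "deviation (strand12 f) (x, y, z) (u, v, w) = deviation f (x, y) (u, v) * kron z w"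
    "deviation (strand23 f) (x, y, z) (u, v, w) = kron x u * deviation f (y, z) (v, w)"
    for x y z u v w
    by (auto simp: deviation_def entry_strand12 entry_strand23 kron_def)
  then have "entries_in m (deviation (strand12 f))" "entries_in m (deviation (strand23 f))"
    using e m by (auto simp: entries_in_def ideal_closed)
  then show "unipotent m (strand12 f)" "unipotent m (strand23 f)"
    using unipotent_iff[OF m lin_strand12, of f] unipotent_iff[OF m lin_strand23, of f] by blast+
qed

lemma strand12_id: "strand12 id = id"
  by (rule lin_eqI) (auto simp: lin_strand12 lin_id entry_strand12 entry_id kron_Pair mult.assoc)

lemma strand23_id: "strand23 id = id"
  by (rule lin_eqI) (auto simp: lin_strand23 lin_id entry_strand23 entry_id kron_Pair mult.assoc)

text \<open>The term \<open>a \<otimes> a\<close> in \<open>(I + a) \<otimes> (I + a)\<close> vanishes because its entries lie in \<open>m\<^sup>2\<close>.\<close>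

lemma deviation_tensor_square:
  assumes m: "is_ideal m" "square_zero m" and \<alpha>: "unipotent m \<alpha>"
  shows "deviation (tensor_map \<alpha> \<alpha>) (x, y) (u, v)
    = deviation \<alpha> x u * kron y v + kron x u * deviation \<alpha> y v"
proof -
  have "deviation \<alpha> x u * deviation \<alpha> y v = 0"
    using m(2) \<alpha> unipotent_iff[OF m(1) unipotent_lin[OF \<alpha>]]
    by (simp add: square_zero_def entries_in_def)
  then show ?thesis
    by (auto simp: deviation_def entry_tensor_map kron_def algebra_simps)
qed

lemma unipotent_tensor_square:
  assumes m: "is_ideal m" "square_zero m" and \<alpha>: "unipotent m \<alpha>"
  shows "unipotent m (tensor_map \<alpha> \<alpha>)"
proof -
  have "entries_in m (deviation (tensor_map \<alpha> \<alpha>))"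
    using \<alpha> unipotent_iff[OF m(1) unipotent_lin[OF \<alpha>]] m(1)
    by (auto simp: entries_in_def deviation_tensor_square[OF assms] ideal_closed)
  then show ?thesis using unipotent_iff[OF m(1) lin_tensor_map] by blast
qed

context rack
begin

section \<open>Entropic maps and Yang-Baxter deformations as matrices\<close>

definition braid :: "'q \<times> 'q \<Rightarrow> 'q \<times> 'q" where
  "braid = (\<lambda>(x, y). (y, rop x y))"

definition braid12 :: "'q \<times> 'q \<times> 'q \<Rightarrow> 'q \<times> 'q \<times> 'q" where
  "braid12 = (\<lambda>(x, y, z). (y, rop x y, z))"

definition braid23 :: "'q \<times> 'q \<times> 'q \<Rightarrow> 'q \<times> 'q \<times> 'q" where
  "braid23 = (\<lambda>(x, y, z). (x, z, rop y z))"

lemma bij_braid: "bij braid"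
proof (rule bijI)
  show "inj braid" by (auto simp: inj_def braid_def)
  show "surj braid"
    unfolding surj_def
  proof
    fix p :: "'q \<times> 'q"
    obtain y t where p: "p = (y, t)" by (cases p)
    obtain x where "rop x y = t" by (rule right_translation_surj)
    then show "\<exists>x. p = braid x" using p by (auto simp: braid_def intro!: exI[of _ "(x, y)"])
  qed
qed

lemma bij_braid12: "bij braid12"
proof (rule bijI)
  show "inj braid12" by (auto simp: inj_def braid12_def)
  show "surj braid12"
    unfolding surj_def
  proof
    fix p :: "'q \<times> 'q \<times> 'q"
    obtain y t z where p: "p = (y, t, z)" by (cases p)
    obtain x where "rop x y = t" by (rule right_translation_surj)
    then show "\<exists>x. p = braid12 x" using p by (auto simp: braid12_def intro!: exI[of _ "(x, y, z)"])
  qed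
qed

lemma bij_braid23: "bij braid23"
proof (rule bijI)
  show "inj braid23" by (auto simp: inj_def braid23_def)
  show "surj braid23"
    unfolding surj_def
  proof
    fix p :: "'q \<times> 'q \<times> 'q"
    obtain x z t where p: "p = (x, z, t)" by (cases p)
    obtain y where "rop y z = t" by (rule right_translation_surj)
    then show "\<exists>x. p = braid23 x" using p by (auto simp: braid23_def intro!: exI[of _ "(x, y, z)"])
  qed
qed

text \<open>Self-distributivity of the rack is the Yang-Baxter equation for its operator.\<close>

lemma braid_relation: "braid12 \<circ> braid23 \<circ> braid12 = braid23 \<circ> braid12 \<circ> braid23"
  by (simp add: fun_eq_iff braid12_def braid23_def flip: self_distrib)

lemma rack_operator_perm: "rack_operator rop = perm_map braid"
  by (simp add: rack_operator_def perm_map_def braid_def case_prod_unfold)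

lemma strand12_perm_comp: "strand12 (perm_map braid \<circ> f) = perm_map braid12 \<circ> strand12 f"
proof (rule lin_eqI)
  fix p q :: "'q \<times> 'q \<times> 'q"
  obtain r where q: "q = braid12 r" using bij_braid12 by (metis bij_pointE)
  obtain x y z u v w where pr: "p = (x, y, z)" "r = (u, v, w)" by (metis prod_cases3)
  have "entry (perm_map braid12 \<circ> strand12 f) p q = entry (strand12 f) p r"
    using bij_braid12 by (simp add: q entry_def lookup_perm_map bij_is_inj)
  moreover have "entry (perm_map braid \<circ> f) (x, y) (braid (u, v)) = entry f (x, y) (u, v)"
    using bij_braid by (simp add: entry_def lookup_perm_map bij_is_inj)
  then have "entry (strand12 (perm_map braid \<circ> f)) p q = entry (strand12 f) p r"
    by (simp add: pr q braid12_def braid_def entry_strand12)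
  ultimately show "entry (strand12 (perm_map braid \<circ> f)) p q
    = entry (perm_map braid12 \<circ> strand12 f) p q" by simp
qed (intro lin_comp lin_perm_map lin_strand12)+

lemma strand23_perm_comp: "strand23 (perm_map braid \<circ> f) = perm_map braid23 \<circ> strand23 f"
proof (rule lin_eqI)
  fix p q :: "'q \<times> 'q \<times> 'q"
  obtain r where q: "q = braid23 r" using bij_braid23 by (metis bij_pointE)
  obtain x y z u v w where pr: "p = (x, y, z)" "r = (u, v, w)" by (metis prod_cases3)
  have "entry (perm_map braid23 \<circ> strand23 f) p q = entry (strand23 f) p r"
    using bij_braid23 by (simp add: q entry_def lookup_perm_map bij_is_inj)
  moreover have "entry (perm_map braid \<circ> f) (y, z) (braid (v, w)) = entry f (y, z) (v, w)"
    using bij_braid by (simp add: entry_def lookup_perm_map bij_is_inj)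
  then have "entry (strand23 (perm_map braid \<circ> f)) p q = entry (strand23 f) p r"
    by (simp add: pr q braid23_def braid_def entry_strand23)
  ultimately show "entry (strand23 (perm_map braid \<circ> f)) p q
    = entry (perm_map braid23 \<circ> strand23 f) p q" by simp
qed (intro lin_comp lin_perm_map lin_strand23)+

lemma strand12_perm: "strand12 (perm_map braid) = perm_map braid12"
  using strand12_perm_comp[of id] by (simp add: strand12_id)

lemma strand23_perm: "strand23 (perm_map braid) = perm_map braid23"
  using strand23_perm_comp[of id] by (simp add: strand23_id)

lemma entropic_conj:
  "entropic rop f \<longleftrightarrow> lin f \<and>
    conj_perm (braid23 \<circ> braid12) (strand12 f) = strand23 f \<and>
    conj_perm braid23 (strand12 f) = conj_perm braid12 (strand23 f) \<and>
    strand12 f = conj_perm (braid12 \<circ> braid23) (strand23 f)"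
  using bij_braid12 bij_braid23
  by (simp add: entropic_def Let_def rack_operator_perm strand12_perm strand23_perm perm_map_comp
      inv_perm_map bij_comp conj_perm_def)

text \<open>Matrix entries of the two sides of each entropic condition. The faces are linear and vanish on
  the identity matrix, which allows replacing \<open>f\<close> by its deviation.\<close>

lemma entry_faces:
  fixes f :: "('q \<times> 'q \<Rightarrow>\<^sub>0 'a::comm_ring_1) \<Rightarrow> ('q \<times> 'q \<Rightarrow>\<^sub>0 'a)"
  shows "entry (conj_perm (braid23 \<circ> braid12) (strand12 f)) p q - entry (strand23 f) p q
      = face0 (deviation f) p q" (is ?f0)
    and "entry (conj_perm braid23 (strand12 f)) p q - entry (conj_perm braid12 (strand23 f)) p q
      = face1 (deviation f) p q" (is ?f1)
    and "entry (strand12 f) p q - entry (conj_perm (braid12 \<circ> braid23) (strand23 f)) p q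
      = face2 (deviation f) p q" (is ?f2)
proof -
  note bij = bij_comp[OF bij_braid12 bij_braid23] bij_comp[OF bij_braid23 bij_braid12]
    bij_braid12 bij_braid23
  obtain x y z u v w where pq: "p = (x, y, z)" "q = (u, v, w)" by (metis prod_cases3)
  show ?f0 ?f1 ?f2
    unfolding bij[THEN entry_conj_perm]
    by (auto simp: pq entry_strand12 entry_strand23 braid12_def braid23_def
        face_defs deviation_def kron_def algebra_simps)
qed

lemma entropic_iff: "entropic rop f \<longleftrightarrow> lin f \<and> entropic_matrix (deviation f)"
  unfolding entropic_conj entropic_matrix_def entry_faces[symmetric]
  by (auto simp: lin_eq_iff lin_conj_perm lin_strand12 lin_strand23)

text \<open>Moving the permutations to the left leaves on each side of the equation the same permutation
  followed on the right by three maps congruent to the identity, whose deviations add up. The six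
  resulting terms pair off into the three faces.\<close>

lemma yang_baxter_iff:
  fixes f :: "('q \<times> 'q \<Rightarrow>\<^sub>0 'a::comm_ring_1) \<Rightarrow> ('q \<times> 'q \<Rightarrow>\<^sub>0 'a)"
  assumes m: "is_ideal m" "square_zero m" and f: "unipotent m f"
  shows "yang_baxter_eq (rack_operator rop \<circ> f) \<longleftrightarrow> cocycle (deviation f)"
proof -
  note bij = bij_comp[OF bij_braid12 bij_braid23] bij_comp[OF bij_braid23 bij_braid12]
    bij_braid12 bij_braid23
  let ?c1 = "perm_map braid12 :: ('q \<times> 'q \<times> 'q \<Rightarrow>\<^sub>0 'a) \<Rightarrow> _"
    and ?c2 = "perm_map braid23 :: ('q \<times> 'q \<times> 'q \<Rightarrow>\<^sub>0 'a) \<Rightarrow> _"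
    and ?f1 = "strand12 f" and ?f2 = "strand23 f"
  let ?L = "conj_perm (braid23 \<circ> braid12) ?f1 \<circ> (conj_perm braid12 ?f2 \<circ> ?f1)"
    and ?R = "conj_perm (braid12 \<circ> braid23) ?f2 \<circ> (conj_perm braid23 ?f1 \<circ> ?f2)"
  have move: "g (perm_map s x) = perm_map s (conj_perm s g x)" if "bij s"
    for s :: "'q \<times> 'q \<times> 'q \<Rightarrow> 'q \<times> 'q \<times> 'q" and g and x :: "'q \<times> 'q \<times> 'q \<Rightarrow>\<^sub>0 'a"
    using perm_map_conj_perm[OF that, of g] by (simp add: fun_eq_iff)
  have L: "?c1 \<circ> ?f1 \<circ> (?c2 \<circ> ?f2) \<circ> (?c1 \<circ> ?f1) = perm_map (braid12 \<circ> braid23 \<circ> braid12) \<circ> ?L"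
    using move[OF bij(1), of ?f1] move[OF bij_braid12, of ?f2]
    by (simp add: fun_eq_iff flip: perm_map_comp)
  have R: "?c2 \<circ> ?f2 \<circ> (?c1 \<circ> ?f1) \<circ> (?c2 \<circ> ?f2) = perm_map (braid12 \<circ> braid23 \<circ> braid12) \<circ> ?R"
    using move[OF bij(2), of ?f2] move[OF bij_braid23, of ?f1]
    by (simp add: fun_eq_iff braid_relation flip: perm_map_comp)
  have "yang_baxter_eq (rack_operator rop \<circ> f) \<longleftrightarrow> ?L = ?R"
    unfolding yang_baxter_eq_def rack_operator_perm strand12_perm_comp strand23_perm_comp L R
    by (rule perm_map_cancel) (intro bij_comp bij)
  also have "\<dots> \<longleftrightarrow> (\<forall>p q. entry ?L p q = entry ?R p q)"
    by (intro lin_eq_iff lin_comp lin_conj_perm lin_strand12 lin_strand23)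
  also have "\<dots> \<longleftrightarrow> cocycle (deviation f)"
  proof -
    have trip: "entry (F \<circ> (G \<circ> H)) p q = entry F p q + entry G p q + entry H p q - 2 * kron p q"
      if "unipotent m F" "unipotent m G" "unipotent m H" for F G H :: "('q \<times> 'q \<times> 'q \<Rightarrow>\<^sub>0 'a) \<Rightarrow> _" and p q
    proof -
      let ?v = "basis p"
      have "F (G (H ?v)) = F (H ?v) + G (H ?v) - H ?v" by (rule unipotent_comp[OF m that(1,2)])
      also have "\<dots> = F ?v + G ?v + H ?v - ?v - ?v"
        by (simp add: unipotent_comp[OF m that(1,3)] unipotent_comp[OF m that(2,3)])
      finally show ?thesis by (simp add: entry_def lookup_add lookup_minus lookup_basis)
    qed
    note u = unipotent_strand[OF m(1) f]
    have "entry ?L p q = entry ?R p q \<longleftrightarrow>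
        face0 (deviation f) p q - face1 (deviation f) p q + face2 (deviation f) p q = 0" for p q
      unfolding entry_faces[symmetric]
      by (subst (1 2) trip) (auto intro!: unipotent_conj_perm m bij u simp: algebra_simps)
    then show ?thesis by (simp add: cocycle_def)
  qed
  finally show ?thesis .
qed

lemma entropic_deformation_yang_baxter:
  assumes "is_ideal m" "square_zero m" and "entropic_deformation m rop c"
  shows "yang_baxter_operator c"
proof -
  obtain f where f: "entropic rop f" "cong_mod m f id" and c: "c = rack_operator rop \<circ> f"
    using assms(3) by (auto simp: entropic_deformation_def)
  then have u: "unipotent m f" by (simp add: entropic_iff unipotent_def)
  have "cocycle (deviation f)"
    using f(1) by (simp add: entropic_iff entropic_matrix_def cocycle_def)
  then have "yang_baxter_eq c" using yang_baxter_iff[OF assms(1,2) u] c by simp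
  moreover have "lin_aut c"
    unfolding lin_aut_def c rack_operator_perm
    by (intro conjI lin_comp lin_perm_map unipotent_lin[OF u] bij_comp[OF unipotent_bij[OF assms(1,2) u]]
        bij_perm_map bij_braid)
  ultimately show ?thesis by (simp add: yang_baxter_operator_def)
qed

section \<open>Equivalence of deformations\<close>

lemma deviation_conj_tensor_square:
  assumes m: "is_ideal m" "square_zero m" and \<alpha>: "unipotent m \<alpha>"
  shows "deviation (conj_perm braid (tensor_map \<alpha> \<alpha>)) p q - deviation (tensor_map \<alpha> \<alpha>) p q
    = coboundary (deviation \<alpha>) p q"
proof -
  obtain x y u v where pq: "p = (x, y)" "q = (u, v)" by (metis surj_pair)
  have "deviation (conj_perm braid (tensor_map \<alpha> \<alpha>)) p q
    = deviation (tensor_map \<alpha> \<alpha>) (braid p) (braid q)"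
    using bij_braid by (simp add: deviation_def entry_conj_perm kron_def bij_is_inj inj_eq)
  then show ?thesis
    by (auto simp: pq braid_def deviation_tensor_square[OF assms] coboundary_def kron_def algebra_simps)
qed

text \<open>With \<open>T = \<alpha> \<otimes> \<alpha>\<close> the equation reads \<open>c g T = T c f\<close>, that is, \<open>g T = (c\<^sup>-\<^sup>1 T c) f\<close>, and now
  deviations add up on both sides.\<close>

lemma equivalence_iff:
  assumes m: "is_ideal m" "square_zero m" and \<alpha>: "unipotent m \<alpha>"
    and f: "unipotent m f" and g: "unipotent m g"
  shows "rack_operator rop \<circ> g
      = tensor_map \<alpha> \<alpha> \<circ> (rack_operator rop \<circ> f) \<circ> inv_into UNIV (tensor_map \<alpha> \<alpha>)
    \<longleftrightarrow> (\<forall>p q. deviation g p q = deviation f p q + coboundary (deviation \<alpha>) p q)"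
proof -
  let ?T = "tensor_map \<alpha> \<alpha>" and ?c = "perm_map braid"
  note T = unipotent_tensor_square[OF m \<alpha>]
  note cT = unipotent_conj_perm[OF m(1) bij_braid T]
  have bijT: "bij ?T" by (rule unipotent_bij[OF m T])
  have "?c \<circ> g = ?T \<circ> (?c \<circ> f) \<circ> inv_into UNIV ?T \<longleftrightarrow> ?c \<circ> g \<circ> ?T = ?T \<circ> (?c \<circ> f)"
  proof
    assume "?c \<circ> g = ?T \<circ> (?c \<circ> f) \<circ> inv_into UNIV ?T"
    then have "?c \<circ> g \<circ> ?T = ?T \<circ> (?c \<circ> f) \<circ> (inv_into UNIV ?T \<circ> ?T)" by (simp add: comp_assoc)
    then show "?c \<circ> g \<circ> ?T = ?T \<circ> (?c \<circ> f)" using bijT by (simp add: bij_is_inj)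
  next
    assume "?c \<circ> g \<circ> ?T = ?T \<circ> (?c \<circ> f)"
    then have "?T \<circ> (?c \<circ> f) \<circ> inv_into UNIV ?T = ?c \<circ> g \<circ> ?T \<circ> inv_into UNIV ?T"
      by (simp only:)
    also have "\<dots> = ?c \<circ> g \<circ> (?T \<circ> inv_into UNIV ?T)"
      by (simp only: comp_assoc)
    finally show "?c \<circ> g = ?T \<circ> (?c \<circ> f) \<circ> inv_into UNIV ?T"
      using bijT by (simp add: surj_iff[THEN iffD1, OF bij_is_surj])
  qed
  also have "\<dots> \<longleftrightarrow> ?c \<circ> (g \<circ> ?T) = ?c \<circ> (conj_perm braid ?T \<circ> f)"
    using perm_map_conj_perm[OF bij_braid, of ?T] by (simp add: comp_assoc[symmetric])
  also have "\<dots> \<longleftrightarrow> g \<circ> ?T = conj_perm braid ?T \<circ> f" by (rule perm_map_cancel[OF bij_braid])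
  also have "\<dots> \<longleftrightarrow> (\<forall>p q. entry (g \<circ> ?T) p q = entry (conj_perm braid ?T \<circ> f) p q)"
    by (intro lin_eq_iff lin_comp unipotent_lin[OF f] unipotent_lin[OF g] unipotent_lin[OF T]
        unipotent_lin[OF cT])
  also have "\<dots> \<longleftrightarrow> (\<forall>p q. deviation g p q = deviation f p q + coboundary (deviation \<alpha>) p q)"
    unfolding entry_unipotent_comp[OF m g T] entry_unipotent_comp[OF m cT f]
      deviation_conj_tensor_square[OF m \<alpha>, symmetric]
    by (simp add: deviation_def algebra_simps)
  finally show ?thesis by (simp add: rack_operator_perm)
qed

end

section \<open>Entropic deformations represent all Yang-Baxter deformations\<close>

theorem theorem15:
  fixes rop :: "'q \<Rightarrow> 'q \<Rightarrow> 'q" and m :: "'a::comm_ring_1 set"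
  assumes "rack rop" and "is_ideal m" and "square_zero m"
  shows "(\<forall>c. entropic_deformation m rop c \<longrightarrow> yang_baxter_eq c) \<and>
    (finite (Inn rop) \<and> of_nat (card (Inn rop)) dvd (1::'a) \<longrightarrow>
      (\<forall>c. yang_baxter_deformation m (rack_operator rop) c \<longrightarrow>
        (\<exists>!c'. entropic_deformation m rop c' \<and> yb_equivalent m c c')))"
proof (intro conjI impI allI)
  interpret rack rop by fact
  note m = assms(2,3)
  show "yang_baxter_eq c" if "entropic_deformation m rop c" for c
    using entropic_deformation_yang_baxter[OF m that] by (simp add: yang_baxter_operator_def)

  fix c assume "finite (Inn rop) \<and> of_nat (card (Inn rop)) dvd (1::'a)"
    and c: "yang_baxter_deformation m (rack_operator rop) c"
  then have fin: "finite (Inn rop)" and inv: "of_nat (card (Inn rop)) dvd (1::'a)" by auto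
  let ?c = "rack_operator rop"
  define f where "f = perm_map (inv_into UNIV braid) \<circ> c"
  have cf: "c = ?c \<circ> f"
    by (simp add: f_def rack_operator_perm comp_assoc[symmetric] perm_map_inverse(2)[OF bij_braid])
  have yb: "yang_baxter_operator c" and cong: "cong_mod m c ?c"
    using c by (auto simp: yang_baxter_deformation_def)
  have f: "unipotent m f"
  proof -
    have "lin f"
      using yb by (simp add: f_def yang_baxter_operator_def lin_aut_def lin_comp lin_perm_map)
    moreover have "lookup (f v - v) k \<in> m" for v k
    proof -
      have "lookup (c v - ?c v) (braid k) \<in> m" using cong unfolding cong_mod_def by blast
      then show ?thesis
        using bij_braid
        by (simp add: cf rack_operator_perm lookup_minus lookup_perm_map bij_is_inj)
    qed
    ultimately show ?thesis by (simp add: unipotent_def cong_mod_def)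
  qed
  have coc: "cocycle (deviation f)"
    using yb yang_baxter_iff[OF m f] by (simp add: cf yang_baxter_operator_def)
  have entries: "entries_in m (deviation f)"
    using f unipotent_iff[OF m(1) unipotent_lin[OF f]] by simp
  obtain a where a: "column_finite a" "entries_in m a"
    and ent: "entropic_matrix (\<lambda>p q. deviation f p q + coboundary a p q)"
    using cocycle_cohomologous_entropic[OF fin inv m(1) coc column_finite_deviation entries] .
  obtain \<alpha> where \<alpha>: "lin \<alpha>" "\<And>p q. entry \<alpha> p q = kron p q + a p q"
    using lin_of_matrix[OF column_finite_add[OF column_finite_kron a(1)]] by metis
  have dev: "deviation \<alpha> = a" by (simp add: fun_eq_iff deviation_def \<alpha>(2))
  have u: "unipotent m \<alpha>" using unipotent_iff[OF m(1) \<alpha>(1)] a(2) dev by simp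
  let ?T = "tensor_map \<alpha> \<alpha>"
  \<comment> \<open>The map with deviation \<open>e + \<delta> a\<close>, written so that linearity is evident.\<close>
  define g where "g v = f v + (conj_perm braid ?T v - ?T v)" for v
  have lin_g: "lin g"
    unfolding g_def[abs_def]
    by (intro lin_add lin_diff unipotent_lin[OF f] lin_conj_perm lin_tensor_map)
  have dev_g: "deviation g p q = deviation f p q + coboundary a p q" for p q
    using deviation_conj_tensor_square[OF m u, of p q]
    by (simp add: dev deviation_def g_def entry_def lookup_add lookup_minus)
  have "entries_in m (coboundary a)"
    using a(2) m(1) by (auto simp: entries_in_def coboundary_def ideal_closed)
  then have g: "unipotent m g"
    using unipotent_iff[OF m(1) lin_g] entries m(1) by (simp add: entries_in_def dev_g ideal_closed)
  have "entropic rop g" using ent lin_g by (simp add: entropic_iff dev_g[abs_def])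
  then have ed: "entropic_deformation m rop (?c \<circ> g)"
    using g by (auto simp: entropic_deformation_def unipotent_def)
  show "\<exists>!c'. entropic_deformation m rop c' \<and> yb_equivalent m c c'"
  proof (rule ex1I)
    have "?c \<circ> g = ?T \<circ> c \<circ> inv_into UNIV ?T"
      using equivalence_iff[OF m u f g] dev dev_g by (simp add: cf)
    then have "yb_equivalent m c (?c \<circ> g)"
      using yb entropic_deformation_yang_baxter[OF m ed] u unipotent_bij[OF m u]
      by (auto simp: yb_equivalent_def lin_aut_def unipotent_def)
    then show "entropic_deformation m rop (?c \<circ> g) \<and> yb_equivalent m c (?c \<circ> g)" using ed by simp
  next
    fix c' assume c': "entropic_deformation m rop c' \<and> yb_equivalent m c c'"
    then obtain h where h: "entropic rop h" "cong_mod m h id" "c' = ?c \<circ> h"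
      by (auto simp: entropic_deformation_def)
    then have uh: "unipotent m h" by (simp add: entropic_iff unipotent_def)
    obtain \<beta> where \<beta>: "unipotent m \<beta>" "c' = tensor_map \<beta> \<beta> \<circ> c \<circ> inv_into UNIV (tensor_map \<beta> \<beta>)"
      using c' by (auto simp: yb_equivalent_def lin_aut_def unipotent_def)
    have dev_h: "deviation h p q = deviation f p q + coboundary (deviation \<beta>) p q" for p q
      by (rule equivalence_iff[OF m \<beta>(1) f uh, THEN iffD1, rule_format])
        (use \<beta>(2) h(3) in \<open>simp add: cf\<close>)
    have diff: "deviation h p q - deviation g p q = coboundary (\<lambda>x u. deviation \<beta> x u - a x u) p q" for p q
      by (simp add: dev_h dev_g coboundary_diff)
    have "entropic_matrix (\<lambda>p q. deviation h p q - deviation g p q)"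
      using h(1) \<open>entropic rop g\<close> by (intro entropic_matrix_diff) (simp_all add: entropic_iff)
    then have "entropic_matrix (coboundary (\<lambda>x u. deviation \<beta> x u - a x u))"
      unfolding diff .
    then have "deviation h p q - deviation g p q = 0" for p q
      unfolding diff by (rule entropic_coboundary_zero[OF fin inv])
    then have "h = g"
      by (intro lin_eqI unipotent_lin[OF uh] lin_g) (simp add: deviation_def)
    then show "c' = ?c \<circ> g" by (simp add: h(3))
  qed
qed

end
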